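(* Let $m\ge 3$. The sum $W+Wu$ in the Clifford algebra is direct, of rank $2^{m-1}$ with ordered basis $X_m$ followed by $X_mu$, and the action of $\psi(\tilde{y}(m))$ on $W\oplus Wu$ by right multiplication is given, with respect to this basis, by \[ \psi(\tau)=u\mapsto\begin{pmatrix}0&I_{2^{m-2}}\\ I_{2^{m-2}}&0\end{pmatrix},\qquad a\mapsto\begin{pmatrix}\eta_m(a)&0\\0&\eta_m(a)^{-1}\end{pmatrix},\qquad s_i\mapsto\begin{pmatrix}\eta_m(s_i)&0\\0&\eta_m(s_i)\end{pmatrix}\ (1\le i\le m-1). \]
   Context: Groups: $x^y=y^{-1}xy$, $[x,y]=x^{-1}y^{-1}xy$; $S_m$ is the symmetric group on $\{1,\dots,m\}$, $s_i=(i,i+1)$; $y(m)=\langle a, S_m \mid [s_1,s_1^{a^k}]=1\ (k\in\mathbb{Z}),\ a^{s_i}=a^{-1}\ (2\le i\le m-1)\rangle$; $\tilde{y}(m)=y(m)\langle\tau\rangle$ is the semidirect product with an involution $\tau$ which inverts $a$ and centralises $S_m$. Ring and form: let $s$ be an indeterminate over $\mathbb{F}_2$, $t=s^2$, and let $R$ be the ring obtained from $\mathbb{F}_2[s,s^{-1}]$ by adjoining the roots $\alpha,\alpha^{-1}$ of $x^2+sx+1$ (so $s=\alpha+\alpha^{-1}$). $V$ is the free $R$-module with basis $u,v_1,\dots,v_m$, with alternating bilinear form $(u,v_i)=(v_i,v_j)=1$ for all $i$ and all $j\ne i$, and $q$ is the quadratic form with this associated bilinear form and $q(u)=1$, $q(v_i)=t^{-1}$.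 $Cl=Cl(V,q)$ is its Clifford algebra (generated by $V$ with relations $w^2=q(w)$, $w\in V$). The homomorphism $\psi:\tilde{y}(m)\to Cl^\times$ is given by $\psi(\tau)=u$, $\psi(a)=s\,uv_1$, $\psi(s_i)=u(v_i+v_{i+1})$. Elements of $\tilde{y}(m)$ act on $Cl$ by right multiplication: $xg:=x\psi(g)$. Let $w=\frac{\alpha^2}{s}+\alpha uv_1+\alpha^{-1}uv_2+s\,v_1v_2\in Cl$. The ordered set $X_m$, of size $2^{m-2}$, is built as follows: start with the list $(w)$; for $k=1,2,\dots,m-2$ successively, append to the current list the elements $x s_{m-k}$ for each $x$ in the current list, in order. $W$ is the $R$-submodule of $Cl$ spanned by $X_m$, $X_mu=\{xu:x\in X_m\}$ with the induced order, and $Wu=\{xu:x\in W\}$. Matrices act on row vectors: the rows of the matrix of $g$ are the coordinates of the images of the basis elements. $\eta_m$ sends $a\mapsto a^{(m)}$, $s_k\mapsto s_k^{(m)}$, where for $m=3$: \[ a^{(3)}=\begin{pmatrix}\alpha&0\\0&\alpha^{-1}\end{pmatrix},\quad s_1^{(3)}=\begin{pmatrix}1&0\\1&1\end{pmatrix},\quad s_2^{(3)}=\begin{pmatrix}0&1\\1&0\end{pmatrix}, \] and for $m\ge4$, with $I=I_{2^{m-3}}$ the identity matrix: \[ a^{(m)}=\begin{pmatrix}a^{(m-1)}&0\\0&(a^{(m-1)})^{-1}\end{pmatrix},\ s_1^{(m)}=\begin{pmatrix}I&0\\ I&I\end{pmatrix},\ s_2^{(m)}=\begin{pmatrix}0&I\\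 I&0\end{pmatrix},\ s_3^{(m)}=\begin{pmatrix}s_2^{(m-1)}&0\\ I&s_2^{(m-1)}\end{pmatrix}, \] and $s_k^{(m)}=\begin{pmatrix}s_{k-1}^{(m-1)}&0\\0&s_{k-1}^{(m-1)}\end{pmatrix}$ for $4\le k\le m-1$. *)

theory Defs
  imports
    "HOL-Library.Z2"
    "HOL-Library.Poly_Mapping"
    "HOL-Computational_Algebra.Polynomial"
    "HOL-Algebra.Sym_Groups"
    "HOL-Algebra.QuotRing"
    "Jordan_Normal_Form.Matrix"
begin

section \<open>Coefficients\<close>

text \<open>
  Laurent polynomials \<open>F_2[s, 1/s]\<close> are the group algebra of the integers over
  \<^typ>\<open>bit\<close>; the monomial \<open>s^k\<close> is \<^term>\<open>Poly_Mapping.single k 1\<close>.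
\<close>

type_synonym laurent = "int \<Rightarrow>\<^sub>0 bit"

definition minpol :: "laurent poly" where
  "minpol = [:1, Poly_Mapping.single 1 1, 1:]"

lemma minpol_not_dvd_1: "\<not> minpol dvd 1"
proof
  assume "minpol dvd 1"
  then obtain k where k: "1 = minpol * k" by (auto simp: dvd_def)
  have "degree (minpol * k) = degree minpol + degree k"
    using k by (intro degree_mult_eq) auto
  then have "degree (1 :: laurent poly) = 2 + degree k"
    unfolding k[symmetric] by (simp add: minpol_def)
  then show False by simp
qed

text \<open>
  The ring \<open>R = F_2[s, 1/s][x] / (x^2 + s x + 1)\<close>. One root of the polynomial is the class
  of \<open>x\<close>; the other one, \<open>s + x\<close>, is its inverse.
\<close>

definition adj_rel :: "laurent poly \<Rightarrow> laurent poly \<Rightarrow> bool" where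
  "adj_rel p q \<longleftrightarrow> minpol dvd (p - q)"

quotient_type adj_ring = "laurent poly" / adj_rel
proof (rule equivpI)
  show "reflp adj_rel" by (simp add: reflp_def adj_rel_def)
  show "symp adj_rel"
    by (rule sympI) (metis adj_rel_def dvd_minus_iff minus_diff_eq)
  show "transp adj_rel"
  proof (rule transpI)
    fix p q r assume "adj_rel p q" "adj_rel q r"
    then have "minpol dvd (p - q) + (q - r)" unfolding adj_rel_def by (rule dvd_add)
    then show "adj_rel p r" by (simp add: adj_rel_def)
  qed
qed

instantiation adj_ring :: comm_ring_1
begin

lift_definition zero_adj_ring :: adj_ring is 0 .
lift_definition one_adj_ring :: adj_ring is 1 .

lift_definition plus_adj_ring :: "adj_ring \<Rightarrow> adj_ring \<Rightarrow> adj_ring" is "(+)"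
  unfolding adj_rel_def add_diff_add by (rule dvd_add)

lift_definition minus_adj_ring :: "adj_ring \<Rightarrow> adj_ring \<Rightarrow> adj_ring" is "(-)"
proof -
  fix a b c d assume "adj_rel a b" "adj_rel c d"
  then have "minpol dvd (a - b) - (c - d)" unfolding adj_rel_def by (rule dvd_diff)
  also have "(a - b) - (c - d) = (a - c) - (b - d)" by (simp add: algebra_simps)
  finally show "adj_rel (a - c) (b - d)" unfolding adj_rel_def .
qed

lift_definition uminus_adj_ring :: "adj_ring \<Rightarrow> adj_ring" is "uminus"
  unfolding adj_rel_def minus_diff_minus by (simp only: dvd_minus_iff)

lift_definition times_adj_ring :: "adj_ring \<Rightarrow> adj_ring \<Rightarrow> adj_ring" is "(*)"
proof -
  fix a b c d assume "adj_rel a b" "adj_rel c d"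
  then have "minpol dvd (a - b) * c + b * (c - d)"
    unfolding adj_rel_def by (intro dvd_add dvd_mult dvd_mult2)
  also have "(a - b) * c + b * (c - d) = a * c - b * d" by (simp add: algebra_simps)
  finally show "adj_rel (a * c) (b * d)" unfolding adj_rel_def .
qed

instance
proof
  fix a b c :: adj_ring
  have eq: "p = q \<Longrightarrow> adj_rel p q" for p q by (simp add: adj_rel_def)
  show "a * b * c = a * (b * c)" by transfer (rule eq, rule mult.assoc)
  show "a * b = b * a" by transfer (rule eq, rule mult.commute)
  show "1 * a = a" by transfer (rule eq, rule mult_1)
  show "(a + b) * c = a * c + b * c" by transfer (rule eq, rule distrib_right)
  show "a + b + c = a + (b + c)" by transfer (rule eq, rule add.assoc)
  show "a + b = b + a" by transfer (rule eq, rule add.commute)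
  show "0 + a = a" by transfer (rule eq, rule add_0)
  show "- a + a = 0" by transfer (rule eq, rule left_minus)
  show "a - b = a + - b" by transfer (rule eq, rule diff_conv_add_uminus)
  show "(0::adj_ring) \<noteq> 1"
    by transfer (simp add: adj_rel_def minpol_not_dvd_1)
qed

end

lift_definition R_alpha :: adj_ring is "[:0, 1:]" .
lift_definition R_alpha_inv :: adj_ring is "[:Poly_Mapping.single 1 1, 1:]" .
lift_definition R_s :: adj_ring is "[:Poly_Mapping.single 1 1:]" .
lift_definition R_s_inv :: adj_ring is "[:Poly_Mapping.single (-1) 1:]" .

text \<open>\<open>t = s^2\<close>\<close>

definition R_t_inv :: adj_ring where
  "R_t_inv = R_s_inv\<^sup>2"

lemma bit_add_self: "(b::bit) + b = 0"
  by (cases b) simp_all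

lemma laurent_double: "(x::laurent) + x = 0"
  by (rule poly_mapping_eqI) (simp only: lookup_add bit_add_self lookup_zero)

lemma R_s_s_inv: "R_s * R_s_inv = 1"
  by transfer (simp add: adj_rel_def mult_single one_pCons)

lemma R_alpha_root: "R_alpha\<^sup>2 + R_s * R_alpha + 1 = 0"
  unfolding power2_eq_square
  by transfer (simp add: adj_rel_def minpol_def one_pCons)

lemma R_alpha_alpha_inv: "R_alpha * R_alpha_inv = 1"
proof -
  have "[:0, 1:] * [:Poly_Mapping.single 1 1, 1:] - 1 = minpol - ((1 :: laurent poly) + 1)"
    by (simp add: minpol_def one_pCons)
  also have "(1 :: laurent poly) + 1 = 0"
    by (simp only: one_pCons add_pCons laurent_double) simp
  finally have "[:0, 1:] * [:Poly_Mapping.single 1 1, 1:] - 1 = minpol"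
    by (simp only: diff_zero)
  then show ?thesis
    by transfer (simp only: adj_rel_def dvd_refl)
qed

lemma R_alpha_plus_alpha_inv: "R_alpha + R_alpha_inv = R_s"
proof -
  have "[:0, 1:] + [:Poly_Mapping.single 1 1, 1:] = [:Poly_Mapping.single 1 1 :: laurent:]"
    by (simp only: add_pCons add_0 laurent_double) simp
  then show ?thesis by transfer (simp only: adj_rel_def diff_self dvd_0_right)
qed

lemma R_double: "(x::adj_ring) + x = 0"
proof -
  have "p + p = 0" for p :: "laurent poly"
    by (rule poly_eqI) (simp only: coeff_add laurent_double coeff_0)
  then show ?thesis by transfer (simp only: adj_rel_def diff_self dvd_0_right)
qed


section \<open>The quadratic module\<close>

text \<open>
  \<open>V\<close> is \<^term>\<open>carrier_vec (m + 1)\<close>, with basis \<open>u\<close> (index 0) and \<open>v_1, ..., v_m\<close>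
  (indices 1 to \<open>m\<close>). Any two distinct basis vectors have inner product 1. The form \<open>q\<close> is
  determined by its polar form and its values on the basis.
\<close>

definition V_u :: "nat \<Rightarrow> adj_ring vec" where
  "V_u m = unit_vec (m + 1) 0"

definition V_v :: "nat \<Rightarrow> nat \<Rightarrow> adj_ring vec" where
  "V_v m i = unit_vec (m + 1) i"

definition V_bil :: "nat \<Rightarrow> adj_ring vec \<Rightarrow> adj_ring vec \<Rightarrow> adj_ring" where
  "V_bil m x y = (\<Sum>i\<le>m. \<Sum>j\<in>{..m} - {i}. x $ i * y $ j)"

definition V_q :: "nat \<Rightarrow> adj_ring vec \<Rightarrow> adj_ring" where
  "V_q m x = (\<Sum>i\<le>m. (if i = 0 then 1 else R_t_inv) * (x $ i)\<^sup>2) + (\<Sum>j\<le>m. \<Sum>i<j. x $ i * x $ j)"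

lemma V_bil_basis:
  assumes "i \<le> m" "j \<le> m"
  shows "V_bil m (unit_vec (m + 1) i) (unit_vec (m + 1) j) = (if i = j then 0 else 1)"
proof -
  have "V_bil m (unit_vec (m + 1) i) (unit_vec (m + 1) j) =
      (\<Sum>k\<le>m. \<Sum>l\<in>{..m} - {k}. if k = i then (if l = j then 1 else 0) else 0)"
    unfolding V_bil_def using assms by (intro sum.cong refl) (auto simp: unit_vec_def)
  also have "\<dots> = (\<Sum>k\<le>m. if k = i then (\<Sum>l\<in>{..m} - {i}. if l = j then 1 else 0) else 0)"
    by (intro sum.cong refl) auto
  also have "\<dots> = (if i = j then 0 else 1)"
    using assms by (auto simp: sum.delta)
  finally show ?thesis .
qed

lemma V_q_basis:
  assumes "i \<le> m"
  shows "V_q m (unit_vec (m + 1) i) = (if i = 0 then 1 else R_t_inv)"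
proof -
  have "(\<Sum>l\<le>m. \<Sum>k<l. unit_vec (m + 1) i $ k * unit_vec (m + 1) i $ l) = (0::adj_ring)"
    using assms by (intro sum.neutral ballI) (auto simp: unit_vec_def)
  moreover have "(\<Sum>k\<le>m. (if k = 0 then 1 else R_t_inv) * (unit_vec (m + 1) i $ k)\<^sup>2) =
      (\<Sum>k\<le>m. if k = i then (if i = 0 then 1 else R_t_inv) else 0)"
    by (intro sum.cong refl) (auto simp: unit_vec_def)
  ultimately show ?thesis
    unfolding V_q_def using assms by (simp add: sum.delta)
qed

lemma V_q_smult:
  assumes "x \<in> carrier_vec (m + 1)"
  shows "V_q m (c \<cdot>\<^sub>v x) = c\<^sup>2 * V_q m x"
proof -
  have ix: "(c \<cdot>\<^sub>v x) $ i = c * x $ i" if "i \<le> m" for i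
    using assms that by simp
  show ?thesis
    unfolding V_q_def distrib_left sum_distrib_left
    by (intro arg_cong2[where f = "(+)"] sum.cong refl)
      (auto simp: ix power_mult_distrib power2_eq_square algebra_simps)
qed

lemma V_q_add:
  assumes "x \<in> carrier_vec (m + 1)" "y \<in> carrier_vec (m + 1)"
  shows "V_q m (x + y) = V_q m x + V_q m y + V_bil m x y"
proof -
  have ix: "(x + y) $ i = x $ i + y $ i" if "i \<le> m" for i
    using assms that by simp
  have sq: "(a + b)\<^sup>2 = a\<^sup>2 + b\<^sup>2" for a b :: adj_ring
  proof -
    have "(a + b)\<^sup>2 = a\<^sup>2 + b\<^sup>2 + (a * b + a * b)"
      by (simp add: power2_eq_square algebra_simps)
    then show ?thesis by (simp only: R_double add_0_right)
  qed
  let ?c = "\<lambda>i::nat. if i = 0 then 1 else R_t_inv"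
  have 1: "(\<Sum>i\<le>m. ?c i * ((x + y) $ i)\<^sup>2) = (\<Sum>i\<le>m. ?c i * (x $ i)\<^sup>2) + (\<Sum>i\<le>m. ?c i * (y $ i)\<^sup>2)"
    unfolding sum.distrib[symmetric] by (intro sum.cong refl) (simp add: ix sq distrib_left)
  have 2: "(\<Sum>j\<le>m. \<Sum>i<j. (x + y) $ i * (x + y) $ j) =
      (\<Sum>j\<le>m. \<Sum>i<j. x $ i * x $ j) + (\<Sum>j\<le>m. \<Sum>i<j. y $ i * y $ j) +
      ((\<Sum>j\<le>m. \<Sum>i<j. x $ i * y $ j) + (\<Sum>j\<le>m. \<Sum>i<j. y $ i * x $ j))"
    unfolding sum.distrib[symmetric] by (intro sum.cong refl) (auto simp: ix algebra_simps)
  have "V_bil m x y = (\<Sum>(i, j)\<in>(SIGMA i:{..m}. {..m} - {i}). x $ i * y $ j)"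
    unfolding V_bil_def by (subst sum.Sigma) auto
  also have "(SIGMA i:{..m}. {..m} - {i}) =
      prod.swap ` (SIGMA j:{..m}. {..<j}) \<union> (SIGMA i:{..m}. {..<i})"
    by (force simp: image_iff)
  also have "(\<Sum>(i, j)\<in>\<dots>. x $ i * y $ j) =
      (\<Sum>(i, j)\<in>prod.swap ` (SIGMA j:{..m}. {..<j}). x $ i * y $ j) +
      (\<Sum>(i, j)\<in>(SIGMA i:{..m}. {..<i}). x $ i * y $ j)"
    by (rule sum.union_disjoint) auto
  also have "(\<Sum>(i, j)\<in>prod.swap ` (SIGMA j:{..m}. {..<j}). x $ i * y $ j) =
      (\<Sum>j\<le>m. \<Sum>i<j. x $ i * y $ j)"
    by (subst sum.reindex) (auto simp: sum.Sigma case_prod_unfold)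
  also have "(\<Sum>(i, j)\<in>(SIGMA i:{..m}. {..<i}). x $ i * y $ j) = (\<Sum>j\<le>m. \<Sum>i<j. y $ i * x $ j)"
    by (subst sum.Sigma) (auto simp: mult.commute)
  finally show ?thesis
    unfolding V_q_def 1 2 by (simp add: algebra_simps)
qed


section \<open>The Clifford algebra\<close>

text \<open>
  The tensor algebra of the free module \<open>V\<close> is the free associative algebra on its basis, that
  is, the monoid algebra of the free monoid on the indices \<open>0, ..., m\<close>.
\<close>

datatype 'a free_mon = FMon (letters: "'a list")

instantiation free_mon :: (type) monoid_add
begin

definition zero_free_mon :: "'a free_mon" where
  "zero_free_mon = FMon []"

definition plus_free_mon :: "'a free_mon \<Rightarrow> 'a free_mon \<Rightarrow> 'a free_mon" where
  "plus_free_mon x y = FMon (letters x @ letters y)"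

instance
  by standard (simp_all add: zero_free_mon_def plus_free_mon_def)

end

type_synonym free_alg = "nat free_mon \<Rightarrow>\<^sub>0 adj_ring"

definition tensor_alg :: "nat \<Rightarrow> free_alg ring" where
  "tensor_alg m = \<lparr>carrier = {p. \<forall>w\<in>Poly_Mapping.keys p. set (letters w) \<subseteq> {..m}},
    mult = (*), one = 1, zero = 0, add = (+)\<rparr>"

definition ta_scalar :: "adj_ring \<Rightarrow> free_alg" where
  "ta_scalar r = Poly_Mapping.single 0 r"

definition ta_vec :: "nat \<Rightarrow> adj_ring vec \<Rightarrow> free_alg" where
  "ta_vec m x = (\<Sum>i\<le>m. Poly_Mapping.single (FMon [i]) (x $ i))"

definition cl_ideal :: "nat \<Rightarrow> free_alg set" where
  "cl_ideal m = Idl\<^bsub>tensor_alg m\<^esub>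
    {ta_vec m x * ta_vec m x - ta_scalar (V_q m x) | x. x \<in> carrier_vec (m + 1)}"

type_synonym cl_elem = "free_alg set"

definition Cl :: "nat \<Rightarrow> cl_elem ring" where
  "Cl m = tensor_alg m Quot cl_ideal m"

definition cl_vec :: "nat \<Rightarrow> adj_ring vec \<Rightarrow> cl_elem" where
  "cl_vec m x = cl_ideal m +>\<^bsub>tensor_alg m\<^esub> ta_vec m x"

definition cl_scale :: "nat \<Rightarrow> adj_ring \<Rightarrow> cl_elem \<Rightarrow> cl_elem" where
  "cl_scale m r x = (cl_ideal m +>\<^bsub>tensor_alg m\<^esub> ta_scalar r) \<otimes>\<^bsub>Cl m\<^esub> x"

lemma tensor_alg_simps:
  "carrier (tensor_alg m) = {p. \<forall>w\<in>Poly_Mapping.keys p. set (letters w) \<subseteq> {..m}}"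
  "x \<otimes>\<^bsub>tensor_alg m\<^esub> y = x * y" "x \<oplus>\<^bsub>tensor_alg m\<^esub> y = x + y"
  "\<one>\<^bsub>tensor_alg m\<^esub> = 1" "\<zero>\<^bsub>tensor_alg m\<^esub> = 0"
  by (simp_all add: tensor_alg_def)

lemma tensor_alg_mult_closed:
  assumes "x \<in> carrier (tensor_alg m)" "y \<in> carrier (tensor_alg m)"
  shows "x * y \<in> carrier (tensor_alg m)"
  using assms Poly_Mapping.keys_mult[of x y]
  by (fastforce simp: tensor_alg_simps plus_free_mon_def)

lemma tensor_alg_add_closed:
  assumes "x \<in> carrier (tensor_alg m)" "y \<in> carrier (tensor_alg m)"
  shows "x + y \<in> carrier (tensor_alg m)"
  using assms Poly_Mapping.keys_add[of x y] by (auto simp: tensor_alg_simps)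

lemma tensor_alg_uminus_closed:
  assumes "x \<in> carrier (tensor_alg m)"
  shows "- x \<in> carrier (tensor_alg m)"
  using assms by (simp add: tensor_alg_simps)

lemma tensor_alg_ring: "ring (tensor_alg m)"
proof (rule ringI)
  show "abelian_group (tensor_alg m)"
  proof (rule abelian_groupI)
    fix x assume x: "x \<in> carrier (tensor_alg m)"
    then show "\<exists>y\<in>carrier (tensor_alg m). y \<oplus>\<^bsub>tensor_alg m\<^esub> x = \<zero>\<^bsub>tensor_alg m\<^esub>"
      using tensor_alg_uminus_closed[OF x] by (intro bexI[of _ "- x"]) (simp_all add: tensor_alg_simps)
  qed (use tensor_alg_add_closed in \<open>auto simp: tensor_alg_simps(2-) ac_simps\<close>,
       simp add: tensor_alg_simps)
  show "monoid (tensor_alg m)"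
  proof (rule monoidI)
    show "\<one>\<^bsub>tensor_alg m\<^esub> \<in> carrier (tensor_alg m)"
      by (simp add: tensor_alg_simps zero_free_mon_def)
  qed (use tensor_alg_mult_closed in \<open>auto simp: tensor_alg_simps(2-) ac_simps\<close>)
qed (auto simp: tensor_alg_simps(2-) algebra_simps)

lemma ta_scalar_closed: "ta_scalar r \<in> carrier (tensor_alg m)"
  by (simp add: ta_scalar_def tensor_alg_simps zero_free_mon_def)

lemma ta_vec_closed: "ta_vec m x \<in> carrier (tensor_alg m)"
proof -
  have "Poly_Mapping.keys (ta_vec m x) \<subseteq> (\<Union>i\<le>m. {FMon [i]})"
    unfolding ta_vec_def by (rule order_trans[OF Poly_Mapping.keys_sum]) (auto split: if_splits)
  then show ?thesis by (fastforce simp: tensor_alg_simps)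
qed

lemma cl_ideal_ideal: "ideal (cl_ideal m) (tensor_alg m)"
proof -
  interpret ring "tensor_alg m" by (rule tensor_alg_ring)
  have "ta_vec m x * ta_vec m x - ta_scalar (V_q m x) \<in> carrier (tensor_alg m)" for x
    using tensor_alg_add_closed[OF tensor_alg_mult_closed[OF ta_vec_closed ta_vec_closed]
        tensor_alg_uminus_closed[OF ta_scalar_closed], of m x x "V_q m x"] by simp
  then show ?thesis
    unfolding cl_ideal_def by (intro genideal_ideal) auto
qed

lemma Cl_ring: "ring (Cl m)"
  unfolding Cl_def by (rule ideal.quotient_is_ring[OF cl_ideal_ideal])

definition cl_lincomb :: "nat \<Rightarrow> (nat \<Rightarrow> adj_ring) \<Rightarrow> cl_elem list \<Rightarrow> cl_elem" where
  "cl_lincomb m c xs = (\<Oplus>\<^bsub>Cl m\<^esub>j\<in>{..<length xs}. cl_scale m (c j) (xs ! j))"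

definition cl_span :: "nat \<Rightarrow> cl_elem list \<Rightarrow> cl_elem set" where
  "cl_span m xs = range (\<lambda>c. cl_lincomb m c xs)"

definition cl_indep :: "nat \<Rightarrow> cl_elem list \<Rightarrow> bool" where
  "cl_indep m xs \<longleftrightarrow> (\<forall>c. cl_lincomb m c xs = \<zero>\<^bsub>Cl m\<^esub> \<longrightarrow> (\<forall>j<length xs. c j = 0))"

definition cl_ordered_basis :: "nat \<Rightarrow> cl_elem list \<Rightarrow> cl_elem set \<Rightarrow> bool" where
  "cl_ordered_basis m xs M \<longleftrightarrow> set xs \<subseteq> carrier (Cl m) \<and> cl_indep m xs \<and> cl_span m xs = M"

text \<open>Row-vector convention: row \<open>i\<close> holds the coordinates of the image of \<open>xs ! i\<close>.\<close>

definition right_mult_matrix :: "nat \<Rightarrow> cl_elem list \<Rightarrow> cl_elem \<Rightarrow> adj_ring mat \<Rightarrow> bool" where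
  "right_mult_matrix m xs g A \<longleftrightarrow>
    A \<in> carrier_mat (length xs) (length xs) \<and>
    (\<forall>i<length xs. xs ! i \<otimes>\<^bsub>Cl m\<^esub> g = cl_lincomb m (\<lambda>j. A $$ (i, j)) xs)"


section \<open>The groups\<close>

text \<open>
  Group words are lists of letters; \<^term>\<open>(x, True)\<close> stands for the generator \<open>x\<close> and
  \<^term>\<open>(x, False)\<close> for its formal inverse. A relation is a pair of words to be made equal.
\<close>

type_synonym 'g gword = "('g \<times> bool) list"

definition winv :: "'g gword \<Rightarrow> 'g gword" where
  "winv w = rev (map (\<lambda>(x, b). (x, \<not> b)) w)"

definition wconj :: "'g gword \<Rightarrow> 'g gword \<Rightarrow> 'g gword" where
  "wconj x y = winv y @ x @ y"

definition wcomm :: "'g gword \<Rightarrow> 'g gword \<Rightarrow> 'g gword" where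
  "wcomm x y = winv x @ winv y @ x @ y"

definition wpow :: "'g gword \<Rightarrow> int \<Rightarrow> 'g gword" where
  "wpow w k = concat (replicate (nat \<bar>k\<bar>) (if k \<ge> 0 then w else winv w))"

inductive pres_cong :: "'g set \<Rightarrow> ('g gword \<times> 'g gword) set \<Rightarrow> 'g gword \<Rightarrow> 'g gword \<Rightarrow> bool"
  for S E where
  relation: "(w, z) \<in> E \<Longrightarrow> pres_cong S E w z"
| cancel: "x \<in> S \<Longrightarrow> pres_cong S E [(x, b), (x, \<not> b)] []"
| refl: "w \<in> lists (S \<times> UNIV) \<Longrightarrow> pres_cong S E w w"
| sym: "pres_cong S E w z \<Longrightarrow> pres_cong S E z w"
| trans: "pres_cong S E w z \<Longrightarrow> pres_cong S E z z' \<Longrightarrow> pres_cong S E w z'"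
| append: "pres_cong S E w z \<Longrightarrow> pres_cong S E w' z' \<Longrightarrow> pres_cong S E (w @ w') (z @ z')"

definition pres_class :: "'g set \<Rightarrow> ('g gword \<times> 'g gword) set \<Rightarrow> 'g gword \<Rightarrow> 'g gword set" where
  "pres_class S E w = {z. pres_cong S E w z}"

definition presented_group ::
  "'g set \<Rightarrow> ('g gword \<times> 'g gword) set \<Rightarrow> 'g gword set monoid" where
  "presented_group S E =
    \<lparr>carrier = pres_class S E ` lists (S \<times> UNIV),
     mult = (\<lambda>A B. \<Union>w\<in>A. \<Union>z\<in>B. pres_class S E (w @ z)),
     one = pres_class S E []\<rparr>"

text \<open>
  The generators of \<open>y(m)\<close> are \<open>a\<close> and all elements of the symmetric group, the latter subject to
  its whole multiplication table. The library multiplies permutations by composing from right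
  to left; the opposite order gives an isomorphic group, via inversion, which fixes the involutions
  \<open>s_i\<close>.
\<close>

datatype ygen = YA | YPerm "nat \<Rightarrow> nat"

abbreviation wa :: "ygen gword" where
  "wa \<equiv> [(YA, True)]"

abbreviation wperm :: "(nat \<Rightarrow> nat) \<Rightarrow> ygen gword" where
  "wperm p \<equiv> [(YPerm p, True)]"

abbreviation ws :: "nat \<Rightarrow> ygen gword" where
  "ws i \<equiv> wperm (Transposition.transpose i (Suc i))"

definition y_gens :: "nat \<Rightarrow> ygen set" where
  "y_gens m = insert YA (YPerm ` carrier (sym_group m))"

definition y_rels :: "nat \<Rightarrow> (ygen gword \<times> ygen gword) set" where
  "y_rels m =
    {(wperm p @ wperm p', wperm (p \<otimes>\<^bsub>sym_group m\<^esub> p')) | p p'.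
       p \<in> carrier (sym_group m) \<and> p' \<in> carrier (sym_group m)} \<union>
    {(wcomm (ws 1) (wconj (ws 1) (wpow wa k)), []) | k. True} \<union>
    {(wconj wa (ws i), winv wa) | i. 2 \<le> i \<and> i \<le> m - 1}"

abbreviation y_class :: "nat \<Rightarrow> ygen gword \<Rightarrow> ygen gword set" where
  "y_class m \<equiv> pres_class (y_gens m) (y_rels m)"

definition y_group :: "nat \<Rightarrow> ygen gword set monoid" where
  "y_group m = presented_group (y_gens m) (y_rels m)"

text \<open>The automorphism of \<open>y(m)\<close> that inverts \<open>a\<close> and fixes the permutations.\<close>

definition y_flip :: "nat \<Rightarrow> ygen gword set \<Rightarrow> ygen gword set" where
  "y_flip m A = (\<Union>w\<in>A. y_class m (map (\<lambda>(x, b). (x, if x = YA then \<not> b else b)) w))"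

text \<open>
  Semidirect product with \<open>\<tau>\<close>: the pair \<^term>\<open>(g, b)\<close> is \<open>g\<close> if \<open>b\<close> is \<^term>\<open>False\<close> and
  \<open>g \<tau>\<close> if \<open>b\<close> is \<^term>\<open>True\<close>.
\<close>

definition ytilde :: "nat \<Rightarrow> (ygen gword set \<times> bool) monoid" where
  "ytilde m =
    \<lparr>carrier = carrier (y_group m) \<times> UNIV,
     mult = (\<lambda>(g, b) (h, c). (g \<otimes>\<^bsub>y_group m\<^esub> (if b then y_flip m h else h), b \<noteq> c)),
     one = (\<one>\<^bsub>y_group m\<^esub>, False)\<rparr>"

definition yt_a :: "nat \<Rightarrow> ygen gword set \<times> bool" where
  "yt_a m = (y_class m wa, False)"

definition yt_s :: "nat \<Rightarrow> nat \<Rightarrow> ygen gword set \<times> bool" where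
  "yt_s m i = (y_class m (ws i), False)"

definition yt_tau :: "nat \<Rightarrow> ygen gword set \<times> bool" where
  "yt_tau m = (\<one>\<^bsub>y_group m\<^esub>, True)"

definition is_psi :: "nat \<Rightarrow> (ygen gword set \<times> bool \<Rightarrow> cl_elem) \<Rightarrow> bool" where
  "is_psi m \<psi> \<longleftrightarrow>
    \<psi> \<in> hom (ytilde m) (units_of (Cl m)) \<and>
    \<psi> (yt_tau m) = cl_vec m (V_u m) \<and>
    \<psi> (yt_a m) = cl_scale m R_s (cl_vec m (V_u m) \<otimes>\<^bsub>Cl m\<^esub> cl_vec m (V_v m 1)) \<and>
    (\<forall>i. 1 \<le> i \<and> i \<le> m - 1 \<longrightarrow>
      \<psi> (yt_s m i) = cl_vec m (V_u m) \<otimes>\<^bsub>Cl m\<^esub> cl_vec m (V_v m i + V_v m (i + 1)))"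


section \<open>The submodule and the matrices\<close>

definition cl_w :: "nat \<Rightarrow> cl_elem" where
  "cl_w m =
    cl_scale m (R_alpha\<^sup>2 * R_s_inv) \<one>\<^bsub>Cl m\<^esub> \<oplus>\<^bsub>Cl m\<^esub>
    cl_scale m R_alpha (cl_vec m (V_u m) \<otimes>\<^bsub>Cl m\<^esub> cl_vec m (V_v m 1)) \<oplus>\<^bsub>Cl m\<^esub>
    cl_scale m R_alpha_inv (cl_vec m (V_u m) \<otimes>\<^bsub>Cl m\<^esub> cl_vec m (V_v m 2)) \<oplus>\<^bsub>Cl m\<^esub>
    cl_scale m R_s (cl_vec m (V_v m 1) \<otimes>\<^bsub>Cl m\<^esub> cl_vec m (V_v m 2))"

text \<open>The list after \<open>k\<close> of the \<open>m - 2\<close> doubling steps.\<close>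

primrec X_step :: "nat \<Rightarrow> (ygen gword set \<times> bool \<Rightarrow> cl_elem) \<Rightarrow> nat \<Rightarrow> cl_elem list" where
  "X_step m \<psi> 0 = [cl_w m]"
| "X_step m \<psi> (Suc k) =
    X_step m \<psi> k @ map (\<lambda>x. x \<otimes>\<^bsub>Cl m\<^esub> \<psi> (yt_s m (m - Suc k))) (X_step m \<psi> k)"

definition X_list :: "nat \<Rightarrow> (ygen gword set \<times> bool \<Rightarrow> cl_elem) \<Rightarrow> cl_elem list" where
  "X_list m \<psi> = X_step m \<psi> (m - 2)"

definition Xu_list :: "nat \<Rightarrow> (ygen gword set \<times> bool \<Rightarrow> cl_elem) \<Rightarrow> cl_elem list" where
  "Xu_list m \<psi> = map (\<lambda>x. x \<otimes>\<^bsub>Cl m\<^esub> cl_vec m (V_u m)) (X_list m \<psi>)"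

definition W_mod :: "nat \<Rightarrow> (ygen gword set \<times> bool \<Rightarrow> cl_elem) \<Rightarrow> cl_elem set" where
  "W_mod m \<psi> = cl_span m (X_list m \<psi>)"

definition Wu_mod :: "nat \<Rightarrow> (ygen gword set \<times> bool \<Rightarrow> cl_elem) \<Rightarrow> cl_elem set" where
  "Wu_mod m \<psi> = (\<lambda>x. x \<otimes>\<^bsub>Cl m\<^esub> cl_vec m (V_u m)) ` W_mod m \<psi>"

abbreviation Mat_ring :: "nat \<Rightarrow> adj_ring mat ring" where
  "Mat_ring n \<equiv> ring_mat TYPE(adj_ring) n ()"

text \<open>
  The matrices of \<open>a\<close> and \<open>s_k\<close> are meaningful for \<open>3 \<le> m\<close> and \<open>1 \<le> k \<le> m - 1\<close>; the values
  outside this range are junk. The inverse is taken in the ring of square matrices.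
\<close>

fun eta_a :: "nat \<Rightarrow> adj_ring mat" where
  "eta_a m =
    (if m \<le> 3 then mat_of_rows_list 2 [[R_alpha, 0], [0, R_alpha_inv]]
     else let n = 2 ^ (m - 3) in
       four_block_mat (eta_a (m - 1)) (0\<^sub>m n n) (0\<^sub>m n n) (inv\<^bsub>Mat_ring n\<^esub> (eta_a (m - 1))))"

fun eta_s :: "nat \<Rightarrow> nat \<Rightarrow> adj_ring mat" where
  "eta_s m k =
    (if m \<le> 3 then
       (if k = 1 then mat_of_rows_list 2 [[1, 0], [1, 1]]
        else mat_of_rows_list 2 [[0, 1], [1, 0]])
     else let n = 2 ^ (m - 3) in
       if k = 1 then four_block_mat (1\<^sub>m n) (0\<^sub>m n n) (1\<^sub>m n) (1\<^sub>m n)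
       else if k = 2 then four_block_mat (0\<^sub>m n n) (1\<^sub>m n) (1\<^sub>m n) (0\<^sub>m n n)
       else if k = 3 then
         four_block_mat (eta_s (m - 1) 2) (0\<^sub>m n n) (1\<^sub>m n) (eta_s (m - 1) 2)
       else
         four_block_mat (eta_s (m - 1) (k - 1)) (0\<^sub>m n n) (0\<^sub>m n n) (eta_s (m - 1) (k - 1)))"

declare eta_a.simps [simp del] eta_s.simps [simp del]

end

theory Submission
  imports Defs
begin

text \<open>
  Put \<open>y_i = v_i + v_{i+1}\<close>, \<open>A = s u v_1\<close>, \<open>B = s v_1 u\<close> and \<open>S_i = u y_i\<close>, so that \<open>A\<close> and \<open>S_i\<close> are the
  images of \<open>a\<close> and \<open>s_i\<close>. The values of the bilinear form show at once that \<open>B\<close> is the inverse of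
  \<open>A\<close>, that \<open>S_i^2 = 1\<close>, that \<open>S_i S_j = S_j S_i\<close> for \<open>|i - j| > 1\<close>, that
  \<open>S_i S_{i+1} = S_{i+1} S_i + 1\<close>, and that \<open>S_i\<close> for \<open>i > 1\<close>, and \<open>u\<close>, exchange \<open>A\<close> and \<open>B\<close>, while \<open>u\<close>
  commutes with every \<open>S_i\<close>. The element \<open>w\<close> factors in two ways,
  \<open>w = (1 + S_1)(A + 1/\<alpha>) = (B + 1/\<alpha>)(1 + S_1)\<close>. As \<open>(A + \<alpha>)(A + 1/\<alpha>) = 0\<close> and
  \<open>(1 + S_1) S_1 = 1 + S_1\<close>, it satisfies \<open>w A = \<alpha> w\<close> and \<open>w S_1 = w\<close>.

  The list \<open>X_m\<close>, and then \<open>X_m\<close> followed by \<open>X_m u\<close>, arises by repeatedly replacing a list \<open>x\<close> by \<open>x, x h\<close>.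
  If \<open>x\<close> spans a space on which \<open>g\<close> and \<open>g'\<close> act by matrices \<open>P\<close> and \<open>P'\<close>, then on the doubled list \<open>g\<close> acts
  by \<open>diag(P, P')\<close> if \<open>h g = g' h\<close>, and by the block matrix with rows \<open>(P, 0)\<close> and \<open>(1, P)\<close> if
  \<open>h g = g h + 1\<close>; and \<open>h\<close> itself exchanges the two halves if \<open>h^2 = 1\<close>. By the relations above, these
  rules are exactly the recursion for \<open>\<eta>_m\<close> (\<open>X_acts\<close>, \<open>L_acts\<close>). Since \<open>u\<close> and
  the \<open>v_i\<close> are obtained from \<open>u\<close>, \<open>A\<close> and the \<open>S_i\<close>, the span is a right ideal, hence stable under
  the whole image of \<open>\<psi>\<close>.

  It remains to see that the list is linearly independent. The matrices themselves suggest a right module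
  of \<open>Cl\<close> on which the list would act as a set of unit vectors; this module is constructed
  independently, on functions on a cube, by giving one operator for each basis vector of \<open>V\<close> and checking the
  Clifford relations (\<open>clifford_module_rep\<close>). A suitable multiple of one unit vector is mapped by the
  elements of the list to distinct unit vectors (\<open>act_X\<close>), so a vanishing
  linear combination has vanishing coefficients.
\<close>

section \<open>Right multiplication on lists in an algebra\<close>

locale scalar_algebra = ring K for K (structure) +
  fixes scale :: "'r::comm_ring_1 \<Rightarrow> 'a \<Rightarrow> 'a" (infixr "\<star>" 75)
  assumes scale_closed [simp, intro]: "x \<in> carrier K \<Longrightarrow> r \<star> x \<in> carrier K"
    and scale_add_left: "x \<in> carrier K \<Longrightarrow> (r + s) \<star> x = r \<star> x \<oplus> s \<star> x"
    and scale_add_right: "x \<in> carrier K \<Longrightarrow> y \<in> carrier K \<Longrightarrow> r \<star> (x \<oplus> y) = r \<star> x \<oplus> r \<star> y"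
    and scale_scale: "x \<in> carrier K \<Longrightarrow> r \<star> (s \<star> x) = (r * s) \<star> x"
    and scale_one [simp]: "x \<in> carrier K \<Longrightarrow> 1 \<star> x = x"
    and scale_mult_left: "x \<in> carrier K \<Longrightarrow> y \<in> carrier K \<Longrightarrow> (r \<star> x) \<otimes> y = r \<star> (x \<otimes> y)"
    and scale_mult_right: "x \<in> carrier K \<Longrightarrow> y \<in> carrier K \<Longrightarrow> x \<otimes> (r \<star> y) = r \<star> (x \<otimes> y)"
begin

lemma scale_zero_left [simp]: "x \<in> carrier K \<Longrightarrow> 0 \<star> x = \<zero>"
  using scale_add_left[of x 0 0] by (simp add: add.l_cancel_one)

lemma scale_zero_right [simp]: "r \<star> \<zero> = \<zero>"
  using scale_add_right[of \<zero> \<zero> r] by (simp add: add.l_cancel_one)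

lemma scale_finsum:
  "finite I \<Longrightarrow> f \<in> I \<rightarrow> carrier K \<Longrightarrow> r \<star> (\<Oplus>i\<in>I. f i) = (\<Oplus>i\<in>I. r \<star> f i)"
  by (induction I rule: finite_induct) (auto simp: scale_add_right Pi_iff)

definition lincomb :: "(nat \<Rightarrow> 'r) \<Rightarrow> 'a list \<Rightarrow> 'a" where
  "lincomb c xs = (\<Oplus>j\<in>{..<length xs}. c j \<star> (xs ! j))"

definition span :: "'a list \<Rightarrow> 'a set" where
  "span xs = range (\<lambda>c. lincomb c xs)"

definition indep :: "'a list \<Rightarrow> bool" where
  "indep xs \<longleftrightarrow> (\<forall>c. lincomb c xs = \<zero> \<longrightarrow> (\<forall>j<length xs. c j = 0))"

definition acts_by :: "'a list \<Rightarrow> 'a \<Rightarrow> 'r mat \<Rightarrow> bool" where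
  "acts_by xs g P \<longleftrightarrow> P \<in> carrier_mat (length xs) (length xs) \<and>
    (\<forall>i<length xs. xs ! i \<otimes> g = lincomb (\<lambda>j. P $$ (i, j)) xs)"

lemma lincomb_closed [simp, intro]: "set xs \<subseteq> carrier K \<Longrightarrow> lincomb c xs \<in> carrier K"
  unfolding lincomb_def by (rule finsum_closed) (auto simp: subset_eq)

lemma lincomb_cong:
  "set xs \<subseteq> carrier K \<Longrightarrow> (\<And>j. j < length xs \<Longrightarrow> c j = d j) \<Longrightarrow> lincomb c xs = lincomb d xs"
  unfolding lincomb_def by (rule finsum_cong') (auto simp: subset_eq)

lemma lincomb_append:
  assumes "set xs \<subseteq> carrier K" "set ys \<subseteq> carrier K"
  shows "lincomb c (xs @ ys) = lincomb c xs \<oplus> lincomb (\<lambda>j. c (length xs + j)) ys"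
  using assms(2)
proof (induction ys rule: rev_induct)
  case Nil
  then show ?case using assms(1) by (simp add: lincomb_def[of _ "[]"])
next
  case (snoc y ys)
  have snoc_eq: "lincomb d (zs @ [z]) = lincomb d zs \<oplus> d (length zs) \<star> z"
    if "set zs \<subseteq> carrier K" "z \<in> carrier K" for d zs z
  proof -
    have "lincomb d (zs @ [z]) =
        d (length zs) \<star> z \<oplus> (\<Oplus>j\<in>{..<length zs}. d j \<star> ((zs @ [z]) ! j))"
      unfolding lincomb_def using that
      by (simp add: lessThan_Suc finsum_insert Pi_iff nth_append subset_eq)
    also have "(\<Oplus>j\<in>{..<length zs}. d j \<star> ((zs @ [z]) ! j)) = lincomb d zs"
      unfolding lincomb_def using that by (intro finsum_cong') (auto simp: nth_append subset_eq)
    finally show ?thesis using that by (simp add: a_comm)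
  qed
  from snoc have "lincomb c (xs @ ys) = lincomb c xs \<oplus> lincomb (\<lambda>j. c (length xs + j)) ys" by simp
  with snoc.prems assms(1) show ?case
    using snoc_eq[of "xs @ ys" y c] snoc_eq[of ys y] by (simp add: a_assoc)
qed

lemma lincomb_0: "set xs \<subseteq> carrier K \<Longrightarrow> lincomb (\<lambda>j. 0) xs = \<zero>"
  unfolding lincomb_def by (rule add.finprod_one_eqI) (auto simp: subset_eq)

lemma lincomb_unit:
  assumes "set xs \<subseteq> carrier K" "i < length xs"
  shows "lincomb (\<lambda>j. if i = j then 1 else 0) xs = xs ! i"
proof -
  have "lincomb (\<lambda>j. if i = j then 1 else 0) xs =
      (\<Oplus>j\<in>{..<length xs}. if i = j then xs ! j else \<zero>)"
    unfolding lincomb_def using assms by (intro finsum_cong') (auto simp: subset_eq)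
  also have "\<dots> = xs ! i"
    using assms by (intro add.finprod_singleton) (auto simp: subset_eq)
  finally show ?thesis .
qed

lemma lincomb_add:
  assumes "set xs \<subseteq> carrier K"
  shows "lincomb (\<lambda>j. c j + d j) xs = lincomb c xs \<oplus> lincomb d xs"
proof -
  have x: "xs ! j \<in> carrier K" if "j < length xs" for j using that assms by (auto simp: subset_eq)
  have "lincomb (\<lambda>j. c j + d j) xs = (\<Oplus>j\<in>{..<length xs}. c j \<star> (xs ! j) \<oplus> d j \<star> (xs ! j))"
    unfolding lincomb_def using x by (intro finsum_cong') (auto simp: scale_add_left)
  also have "\<dots> = lincomb c xs \<oplus> lincomb d xs"
    unfolding lincomb_def using x by (intro finsum_addf) auto
  finally show ?thesis .
qed

lemma lincomb_scale:
  "set xs \<subseteq> carrier K \<Longrightarrow> lincomb (\<lambda>j. r * c j) xs = r \<star> lincomb c xs"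
  unfolding lincomb_def
  by (subst scale_finsum) (auto simp: subset_eq scale_scale intro!: finsum_cong')

lemma lincomb_mult:
  "set xs \<subseteq> carrier K \<Longrightarrow> h \<in> carrier K \<Longrightarrow>
    lincomb c xs \<otimes> h = lincomb c (map (\<lambda>x. x \<otimes> h) xs)"
  unfolding lincomb_def
  by (subst finsum_ldistr) (auto simp: subset_eq scale_mult_left intro!: finsum_cong')

lemma span_closed: "set xs \<subseteq> carrier K \<Longrightarrow> span xs \<subseteq> carrier K"
  unfolding span_def by auto

lemma span_add: "set xs \<subseteq> carrier K \<Longrightarrow> x \<in> span xs \<Longrightarrow> y \<in> span xs \<Longrightarrow> x \<oplus> y \<in> span xs"
  unfolding span_def by (auto simp: lincomb_add[symmetric])

lemma span_scale: "set xs \<subseteq> carrier K \<Longrightarrow> x \<in> span xs \<Longrightarrow> r \<star> x \<in> span xs"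
  unfolding span_def by (auto simp: lincomb_scale[symmetric])

lemma span_0: "set xs \<subseteq> carrier K \<Longrightarrow> \<zero> \<in> span xs"
  unfolding span_def using lincomb_0[of xs] by (metis rangeI)

lemma span_map_mult:
  "set xs \<subseteq> carrier K \<Longrightarrow> h \<in> carrier K \<Longrightarrow> span (map (\<lambda>x. x \<otimes> h) xs) = (\<lambda>x. x \<otimes> h) ` span xs"
  unfolding span_def by (simp add: image_image lincomb_mult)

lemma lincomb_append_if:
  assumes "set xs \<subseteq> carrier K" "set ys \<subseteq> carrier K"
  shows "lincomb (\<lambda>j. if j < length xs then c j else d (j - length xs)) (xs @ ys)
    = lincomb c xs \<oplus> lincomb d ys"
  unfolding lincomb_append[OF assms]
  by (intro arg_cong2[where f = "(\<oplus>)"] lincomb_cong) (use assms in auto)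

lemma span_append:
  assumes "set xs \<subseteq> carrier K" "set ys \<subseteq> carrier K"
  shows "span (xs @ ys) = span xs <+>\<^bsub>K\<^esub> span ys"
proof
  show "span (xs @ ys) \<subseteq> span xs <+>\<^bsub>K\<^esub> span ys"
    unfolding span_def set_add_def' using lincomb_append[OF assms] by blast
  show "span xs <+>\<^bsub>K\<^esub> span ys \<subseteq> span (xs @ ys)"
    unfolding span_def set_add_def' using lincomb_append_if[OF assms, symmetric] by blast
qed

lemma indep_append_span_Int:
  assumes "set xs \<subseteq> carrier K" "set ys \<subseteq> carrier K" "indep (xs @ ys)"
  shows "span xs \<inter> span ys = {\<zero>}"
proof -
  have "x = \<zero>" if "x \<in> span xs" "x \<in> span ys" for x
  proof -
    from that obtain c d where c: "x = lincomb c xs" and d: "x = lincomb d ys"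
      unfolding span_def by blast
    let ?e = "\<lambda>j. if j < length xs then c j else - 1 * d (j - length xs)"
    have x: "x \<in> carrier K" using assms(1) c by simp
    have "lincomb ?e (xs @ ys) = x \<oplus> (- 1) \<star> x"
      using lincomb_append_if[OF assms(1,2), of c "\<lambda>j. - 1 * d j"] lincomb_scale[OF assms(2), of "- 1" d]
      by (simp only: c[symmetric] d[symmetric])
    also have "\<dots> = \<zero>"
      using scale_add_left[of x 1 "- 1"] x by simp
    finally have "\<forall>j<length (xs @ ys). ?e j = 0" using assms(3) unfolding indep_def by blast
    then have "c j = 0" if "j < length xs" for j
      using that by (auto dest: spec[of _ j])
    then have "lincomb c xs = lincomb (\<lambda>j. 0) xs" using assms(1) by (intro lincomb_cong) auto
    then show ?thesis using c lincomb_0[OF assms(1)] by simp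
  qed
  then show ?thesis using span_0 assms(1,2) by blast
qed

lemma acts_by_span:
  assumes "set xs \<subseteq> carrier K" "g \<in> carrier K" "acts_by xs g P" "x \<in> span xs"
  shows "x \<otimes> g \<in> span xs"
proof -
  obtain c where c: "x = lincomb c xs" using assms(4) unfolding span_def by blast
  have "(\<Oplus>j\<in>J. c j \<star> (map (\<lambda>x. x \<otimes> g) xs ! j)) \<in> span xs" if "finite J" "J \<subseteq> {..<length xs}" for J
    using that
  proof (induction J rule: finite_induct)
    case empty
    then show ?case using span_0 assms(1) by simp
  next
    case (insert j J)
    have "map (\<lambda>x. x \<otimes> g) xs ! j \<in> span xs"
      using insert.prems assms(3) by (auto simp: acts_by_def span_def)
    moreover have "map (\<lambda>x. x \<otimes> g) xs ! i \<in> carrier K" if "i < length xs" for i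
      using that assms(1,2) by (auto simp: subset_eq)
    ultimately show ?case
      using insert assms(1) by (subst finsum_insert) (auto intro!: span_add span_scale)
  qed
  from this[of "{..<length xs}"] show ?thesis
    unfolding c lincomb_mult[OF assms(1,2)] by (simp add: lincomb_def)
qed

text \<open>
  If \<open>g\<close> acts on \<open>x\<close> by \<open>P\<close> and \<open>h g' = g h\<close>, then \<open>(x h) g' = (x g) h\<close>, so that \<open>g'\<close> acts on \<open>x h\<close> by
  the same matrix.
\<close>

lemma acts_by_map:
  assumes "set xs \<subseteq> carrier K" "g \<in> carrier K" "g' \<in> carrier K" "h \<in> carrier K"
    and "acts_by xs g P" "h \<otimes> g' = g \<otimes> h"
  shows "acts_by (map (\<lambda>x. x \<otimes> h) xs) g' P"
  unfolding acts_by_def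
proof (intro conjI allI impI)
  show "P \<in> carrier_mat (length (map (\<lambda>x. x \<otimes> h) xs)) (length (map (\<lambda>x. x \<otimes> h) xs))"
    using assms(5) by (simp add: acts_by_def)
next
  fix i assume i: "i < length (map (\<lambda>x. x \<otimes> h) xs)"
  have x: "xs ! i \<in> carrier K" using i assms(1) by (auto simp: subset_eq)
  have "map (\<lambda>x. x \<otimes> h) xs ! i \<otimes> g' = xs ! i \<otimes> g \<otimes> h"
    using i x assms(2-4,6) by (simp add: m_assoc)
  also have "\<dots> = lincomb (\<lambda>j. P $$ (i, j)) (map (\<lambda>x. x \<otimes> h) xs)"
    using i assms by (simp add: acts_by_def lincomb_mult)
  finally show "map (\<lambda>x. x \<otimes> h) xs ! i \<otimes> g' = lincomb (\<lambda>j. P $$ (i, j)) (map (\<lambda>x. x \<otimes> h) xs)" .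
qed

lemma acts_by_four_block:
  assumes xs: "set xs \<subseteq> carrier K" "length xs = n" and ys: "set ys \<subseteq> carrier K" "length ys = n"
    and mats: "P \<in> carrier_mat n n" "Q \<in> carrier_mat n n" "P' \<in> carrier_mat n n" "Q' \<in> carrier_mat n n"
    and upper: "\<And>i. i < n \<Longrightarrow>
      xs ! i \<otimes> g = lincomb (\<lambda>j. P $$ (i, j)) xs \<oplus> lincomb (\<lambda>j. Q $$ (i, j)) ys"
    and lower: "\<And>i. i < n \<Longrightarrow>
      ys ! i \<otimes> g = lincomb (\<lambda>j. P' $$ (i, j)) xs \<oplus> lincomb (\<lambda>j. Q' $$ (i, j)) ys"
  shows "acts_by (xs @ ys) g (four_block_mat P Q P' Q')"
  unfolding acts_by_def
proof (intro conjI allI impI)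
  show "four_block_mat P Q P' Q' \<in> carrier_mat (length (xs @ ys)) (length (xs @ ys))"
    using mats xs ys by simp
next
  fix i assume i: "i < length (xs @ ys)"
  let ?F = "four_block_mat P Q P' Q'"
  have *: "lincomb (\<lambda>j. ?F $$ (i, j)) (xs @ ys) =
      lincomb (\<lambda>j. (if i < n then P $$ (i, j) else P' $$ (i - n, j))) xs \<oplus>
      lincomb (\<lambda>j. (if i < n then Q $$ (i, j) else Q' $$ (i - n, j))) ys"
    unfolding lincomb_append[OF xs(1) ys(1)] using i xs ys mats
    by (intro arg_cong2[where f = "(\<oplus>)"] lincomb_cong) auto
  show "(xs @ ys) ! i \<otimes> g = lincomb (\<lambda>j. ?F $$ (i, j)) (xs @ ys)"
  proof (cases "i < n")
    case True
    then show ?thesis unfolding * using upper[of i] xs by (simp add: nth_append)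
  next
    case False
    then show ?thesis unfolding * using lower[of "i - n"] xs ys i by (simp add: nth_append)
  qed
qed

lemma lincomb_zero_mat:
  "set xs \<subseteq> carrier K \<Longrightarrow> length xs = n \<Longrightarrow> i < n \<Longrightarrow> lincomb (\<lambda>j. 0\<^sub>m n n $$ (i, j)) xs = \<zero>"
  by (subst lincomb_0[symmetric, of xs]) (auto intro!: lincomb_cong)

lemma lincomb_one_mat:
  "set xs \<subseteq> carrier K \<Longrightarrow> length xs = n \<Longrightarrow> i < n \<Longrightarrow> lincomb (\<lambda>j. 1\<^sub>m n $$ (i, j)) xs = xs ! i"
  by (subst lincomb_unit[symmetric, of xs i]) (auto intro!: lincomb_cong)

lemma acts_by_diag:
  assumes "set xs \<subseteq> carrier K" "length xs = n" "set ys \<subseteq> carrier K" "length ys = n"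
    and "acts_by xs g P" "acts_by ys g Q"
  shows "acts_by (xs @ ys) g (four_block_mat P (0\<^sub>m n n) (0\<^sub>m n n) Q)"
  using assms by (intro acts_by_four_block) (auto simp: acts_by_def lincomb_zero_mat)

lemma acts_by_fixed:
  assumes "set xs \<subseteq> carrier K" "\<And>x. x \<in> set xs \<Longrightarrow> x \<otimes> g = x"
  shows "acts_by xs g (1\<^sub>m (length xs))"
  using assms by (simp add: acts_by_def lincomb_one_mat)

text \<open>
  The rules for passing from a list \<open>x\<close> to \<open>x, x h\<close>. Which one applies depends only on how \<open>h\<close> and the
  acting element commute.
\<close>

context
  fixes xs :: "'a list" and n :: nat and h :: 'a
  assumes xs: "set xs \<subseteq> carrier K" "length xs = n" and h: "h \<in> carrier K"
begin

lemma doubled: "set (map (\<lambda>x. x \<otimes> h) xs) \<subseteq> carrier K" "length (map (\<lambda>x. x \<otimes> h) xs) = n"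
  using xs h by auto

lemma acts_by_double_self:
  assumes "h \<otimes> h = \<one>"
  shows "acts_by (xs @ map (\<lambda>x. x \<otimes> h) xs) h (four_block_mat (0\<^sub>m n n) (1\<^sub>m n) (1\<^sub>m n) (0\<^sub>m n n))"
proof (rule acts_by_four_block[OF xs doubled])
  fix i assume i: "i < n"
  then have x: "xs ! i \<in> carrier K" using xs by (auto simp: subset_eq)
  then show "xs ! i \<otimes> h = lincomb (\<lambda>j. 0\<^sub>m n n $$ (i, j)) xs
      \<oplus> lincomb (\<lambda>j. 1\<^sub>m n $$ (i, j)) (map (\<lambda>x. x \<otimes> h) xs)"
    using i xs h by (simp add: lincomb_zero_mat[OF xs] lincomb_one_mat[OF doubled])
  show "map (\<lambda>x. x \<otimes> h) xs ! i \<otimes> h = lincomb (\<lambda>j. 1\<^sub>m n $$ (i, j)) xs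
      \<oplus> lincomb (\<lambda>j. 0\<^sub>m n n $$ (i, j)) (map (\<lambda>x. x \<otimes> h) xs)"
    using i x xs h assms by (simp add: lincomb_one_mat[OF xs] lincomb_zero_mat[OF doubled] m_assoc)
qed auto

lemma acts_by_double_twisted:
  assumes g: "g \<in> carrier K" "g' \<in> carrier K" "h \<otimes> g = g' \<otimes> h" and "acts_by xs g P" "acts_by xs g' P'"
  shows "acts_by (xs @ map (\<lambda>x. x \<otimes> h) xs) g (four_block_mat P (0\<^sub>m n n) (0\<^sub>m n n) P')"
  using assms h xs by (intro acts_by_diag acts_by_map[of xs g' g h]) auto

lemma acts_by_double_braided:
  assumes g: "g \<in> carrier K" "h \<otimes> g = g \<otimes> h \<oplus> \<one>" and "acts_by xs g P"
  shows "acts_by (xs @ map (\<lambda>x. x \<otimes> h) xs) g (four_block_mat P (0\<^sub>m n n) (1\<^sub>m n) P)"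
proof (rule acts_by_four_block[OF xs doubled])
  fix i assume i: "i < n"
  then have x: "xs ! i \<in> carrier K" using xs by (auto simp: subset_eq)
  have P: "lincomb (\<lambda>j. P $$ (i, j)) xs = xs ! i \<otimes> g" using i assms(3) xs by (simp add: acts_by_def)
  show "xs ! i \<otimes> g = lincomb (\<lambda>j. P $$ (i, j)) xs
      \<oplus> lincomb (\<lambda>j. 0\<^sub>m n n $$ (i, j)) (map (\<lambda>x. x \<otimes> h) xs)"
    using i x g P by (simp add: lincomb_zero_mat[OF doubled])
  have "lincomb (\<lambda>j. P $$ (i, j)) (map (\<lambda>x. x \<otimes> h) xs) = xs ! i \<otimes> g \<otimes> h"
    using lincomb_mult[OF xs(1) h] P by metis
  then show "map (\<lambda>x. x \<otimes> h) xs ! i \<otimes> g = lincomb (\<lambda>j. 1\<^sub>m n $$ (i, j)) xs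
      \<oplus> lincomb (\<lambda>j. P $$ (i, j)) (map (\<lambda>x. x \<otimes> h) xs)"
    using i x xs h g by (simp add: lincomb_one_mat[OF xs] m_assoc r_distr a_comm)
qed (use assms(3) xs in \<open>auto simp: acts_by_def\<close>)

end

end

section \<open>The matrices of the recursion\<close>

lemma Units_diag_inv:
  assumes "P \<in> Units (Mat_ring n)"
  defines "P' \<equiv> inv\<^bsub>Mat_ring n\<^esub> P"
  shows "four_block_mat P (0\<^sub>m n n) (0\<^sub>m n n) P' \<in> Units (Mat_ring (n + n))"
    and "inv\<^bsub>Mat_ring (n + n)\<^esub> (four_block_mat P (0\<^sub>m n n) (0\<^sub>m n n) P') =
      four_block_mat P' (0\<^sub>m n n) (0\<^sub>m n n) P"
proof -
  interpret M: ring "Mat_ring n" by (rule ring_mat)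
  interpret M2: ring "Mat_ring (n + n)" by (rule ring_mat)
  have P: "P \<in> carrier_mat n n" "P' \<in> carrier_mat n n"
    using M.Units_closed[OF assms(1)] M.Units_inv_closed[OF assms(1)]
    by (simp_all add: P'_def ring_mat_simps)
  have PP: "P * P' = 1\<^sub>m n" "P' * P = 1\<^sub>m n"
    using M.Units_r_inv[OF assms(1)] M.Units_l_inv[OF assms(1)] by (simp_all add: P'_def ring_mat_simps)
  let ?F = "\<lambda>P P'. four_block_mat P (0\<^sub>m n n) (0\<^sub>m n n) P'"
  have carr: "?F P P' \<in> carrier (Mat_ring (n + n))" "?F P' P \<in> carrier (Mat_ring (n + n))"
    using P by (simp_all add: ring_mat_simps)
  have mult: "?F P P' \<otimes>\<^bsub>Mat_ring (n + n)\<^esub> ?F P' P = \<one>\<^bsub>Mat_ring (n + n)\<^esub>"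
    "?F P' P \<otimes>\<^bsub>Mat_ring (n + n)\<^esub> ?F P P' = \<one>\<^bsub>Mat_ring (n + n)\<^esub>"
    using P by (simp_all add: ring_mat_simps mult_four_block_mat[where ?nr1.0 = n and ?n1.0 = n and ?n2.0 = n
          and ?nr2.0 = n and ?nc1.0 = n and ?nc2.0 = n] PP)
  show "?F P P' \<in> Units (Mat_ring (n + n))"
    unfolding Units_def using carr mult by blast
  show "inv\<^bsub>Mat_ring (n + n)\<^esub> (?F P P') = ?F P' P"
    by (rule M2.inv_unique'[OF carr mult, symmetric])
qed

lemma Units_scalar_mat:
  assumes "c * d = 1"
  shows "mat 1 1 (\<lambda>_. c) \<in> Units (Mat_ring 1)"
    and "inv\<^bsub>Mat_ring 1\<^esub> (mat 1 1 (\<lambda>_. c)) = mat 1 1 (\<lambda>_. d)"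
proof -
  interpret M: ring "Mat_ring 1" by (rule ring_mat)
  have carr: "mat 1 1 (\<lambda>_. c) \<in> carrier (Mat_ring 1)" "mat 1 1 (\<lambda>_. d) \<in> carrier (Mat_ring 1)"
    by (simp_all add: ring_mat_simps)
  have mult: "mat 1 1 (\<lambda>_. c) \<otimes>\<^bsub>Mat_ring 1\<^esub> mat 1 1 (\<lambda>_. d) = \<one>\<^bsub>Mat_ring 1\<^esub>"
     "mat 1 1 (\<lambda>_. d) \<otimes>\<^bsub>Mat_ring 1\<^esub> mat 1 1 (\<lambda>_. c) = \<one>\<^bsub>Mat_ring 1\<^esub>"
    using assms by (auto simp: ring_mat_simps scalar_prod_def ac_simps intro!: eq_matI)
  show "mat 1 1 (\<lambda>_. c) \<in> Units (Mat_ring 1)" unfolding Units_def using carr mult by blast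
  show "inv\<^bsub>Mat_ring 1\<^esub> (mat 1 1 (\<lambda>_. c)) = mat 1 1 (\<lambda>_. d)"
    by (rule M.inv_unique'[OF carr mult, symmetric])
qed

lemma eta_a_3:
  "eta_a 3 = four_block_mat (mat 1 1 (\<lambda>_. R_alpha)) (0\<^sub>m 1 1) (0\<^sub>m 1 1) (mat 1 1 (\<lambda>_. R_alpha_inv))"
  by (rule eq_matI) (auto simp: eta_a.simps mat_of_rows_list_def less_2_cases_iff)

text \<open>
  At the bottom of the recursion the two matrices of size 2 already have the block form that the recursion
  prescribes at the higher levels, with blocks of size 1.
\<close>

lemma eta_s_1:
  assumes "3 \<le> m"
  shows "eta_s m 1 = four_block_mat (1\<^sub>m (2 ^ (m - 3))) (0\<^sub>m (2 ^ (m - 3)) (2 ^ (m - 3)))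
    (1\<^sub>m (2 ^ (m - 3))) (1\<^sub>m (2 ^ (m - 3)))"
proof (cases "m = 3")
  case True
  then show ?thesis
    by (intro eq_matI) (auto simp: eta_s.simps mat_of_rows_list_def less_2_cases_iff)
qed (use assms in \<open>simp add: eta_s.simps Let_def\<close>)

lemma eta_s_2:
  assumes "3 \<le> m"
  shows "eta_s m 2 = four_block_mat (0\<^sub>m (2 ^ (m - 3)) (2 ^ (m - 3))) (1\<^sub>m (2 ^ (m - 3)))
    (1\<^sub>m (2 ^ (m - 3))) (0\<^sub>m (2 ^ (m - 3)) (2 ^ (m - 3)))"
proof (cases "m = 3")
  case True
  then show ?thesis
    by (intro eq_matI) (auto simp: eta_s.simps mat_of_rows_list_def less_2_cases_iff)
qed (use assms in \<open>simp add: eta_s.simps Let_def\<close>)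

section \<open>Relations in the Clifford algebra\<close>

lemma R_two: "(2 :: adj_ring) = 0"
  using R_double[of 1] by simp

text \<open>
  The relations between the basis vectors of \<open>V\<close>, stated in an arbitrary algebra. In characteristic 2 there
  are no signs.
\<close>

locale clifford_generators = scalar_algebra K scale
  for K (structure) and scale :: "adj_ring \<Rightarrow> 'a \<Rightarrow> 'a" (infixr "\<star>" 75) +
  fixes m :: nat and u :: 'a and v :: "nat \<Rightarrow> 'a"
  assumes m: "3 \<le> m"
    and u [simp]: "u \<in> carrier K"
    and v [simp]: "1 \<le> i \<Longrightarrow> i \<le> m \<Longrightarrow> v i \<in> carrier K"
    and u_sq: "u \<otimes> u = \<one>"
    and v_sq: "1 \<le> i \<Longrightarrow> i \<le> m \<Longrightarrow> v i \<otimes> v i = R_t_inv \<star> \<one>"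
    and u_v: "1 \<le> i \<Longrightarrow> i \<le> m \<Longrightarrow> u \<otimes> v i = v i \<otimes> u \<oplus> \<one>"
    and v_v: "1 \<le> i \<Longrightarrow> i \<le> m \<Longrightarrow> 1 \<le> j \<Longrightarrow> j \<le> m \<Longrightarrow> i \<noteq> j \<Longrightarrow>
      v i \<otimes> v j = v j \<otimes> v i \<oplus> \<one>"
begin

lemma add_self: "x \<in> carrier K \<Longrightarrow> x \<oplus> x = \<zero>"
  using scale_add_left[of x 1 1] by (simp add: R_double)

lemma add_cancel: "x \<in> carrier K \<Longrightarrow> y \<in> carrier K \<Longrightarrow> x \<oplus> (x \<oplus> y) = y"
  by (simp add: a_assoc[symmetric] add_self)

text \<open>
  \<open>A\<close>, \<open>B\<close> and \<open>S i\<close> are the images of \<open>a\<close>, its inverse and \<open>s_i\<close>. The product defining \<open>w\<close> is chosen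
  because it exhibits \<open>w\<close> as an eigenvector of \<open>A\<close>; \<open>w_expand\<close> returns to the sum of four terms.
\<close>

definition y :: "nat \<Rightarrow> 'a" where "y i = v i \<oplus> v (Suc i)"
definition S :: "nat \<Rightarrow> 'a" where "S i = u \<otimes> y i"
definition A :: 'a where "A = R_s \<star> (u \<otimes> v 1)"
definition B :: 'a where "B = R_s \<star> (v 1 \<otimes> u)"
definition w :: 'a where "w = (\<one> \<oplus> S 1) \<otimes> (A \<oplus> R_alpha_inv \<star> \<one>)"

lemma v1 [simp]: "v (Suc 0) \<in> carrier K"
  using v[of 1] m by simp

lemma y_closed [simp]: "1 \<le> i \<Longrightarrow> i < m \<Longrightarrow> y i \<in> carrier K"
  unfolding y_def by simp

lemma S_closed [simp]: "1 \<le> i \<Longrightarrow> i < m \<Longrightarrow> S i \<in> carrier K"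
  unfolding S_def by simp

lemma S_1_closed [simp]: "S (Suc 0) \<in> carrier K"
  using S_closed[of 1] m by simp

lemma A_closed [simp]: "A \<in> carrier K" and B_closed [simp]: "B \<in> carrier K"
  unfolding A_def B_def by simp_all

lemma w_closed [simp]: "w \<in> carrier K"
  unfolding w_def by simp

lemma y_sq: "1 \<le> i \<Longrightarrow> i < m \<Longrightarrow> y i \<otimes> y i = \<one>"
  unfolding y_def
  by (simp add: l_distr r_distr v_sq v_v[of i "Suc i"] a_ac add_self add_cancel)

lemma u_y: "1 \<le> i \<Longrightarrow> i < m \<Longrightarrow> u \<otimes> y i = y i \<otimes> u"
  unfolding y_def by (simp add: l_distr r_distr u_v a_ac add_self add_cancel)

lemma v_y:
  assumes "1 \<le> k" "k \<le> m" "1 \<le> i" "i < m"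
  shows "y i \<otimes> v k = (if k = i \<or> k = Suc i then v k \<otimes> y i \<oplus> \<one> else v k \<otimes> y i)"
  unfolding y_def using assms v_v[of i k] v_v[of "Suc i" k]
  by (auto simp: l_distr r_distr a_ac add_self add_cancel)

lemma y_y:
  assumes "1 \<le> i" "i < m" "1 \<le> j" "j < m" "i \<noteq> j"
  shows "y i \<otimes> y j = (if j = Suc i \<or> i = Suc j then y j \<otimes> y i \<oplus> \<one> else y j \<otimes> y i)"
proof -
  have "y i \<otimes> y j = y i \<otimes> v j \<oplus> y i \<otimes> v (Suc j)"
    using assms by (simp add: y_def[of j] r_distr)
  moreover have "y j \<otimes> y i = v j \<otimes> y i \<oplus> v (Suc j) \<otimes> y i"
    using assms by (simp add: y_def[of j] l_distr)
  ultimately show ?thesis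
    using assms v_y[of j i] v_y[of "Suc j" i] by (auto simp: a_ac add_self add_cancel)
qed

lemma S_S:
  assumes "1 \<le> i" "i < m" "1 \<le> j" "j < m"
  shows "S i \<otimes> S j = y i \<otimes> y j"
proof -
  have "S i \<otimes> S j = y i \<otimes> (u \<otimes> u) \<otimes> y j"
    unfolding S_def using assms by (simp add: m_assoc u_y)
  then show ?thesis using assms by (simp add: u_sq)
qed

lemma S_sq: "1 \<le> i \<Longrightarrow> i < m \<Longrightarrow> S i \<otimes> S i = \<one>"
  by (simp add: S_S y_sq)

lemma S_braid: "1 \<le> i \<Longrightarrow> Suc i < m \<Longrightarrow> S i \<otimes> S (Suc i) = S (Suc i) \<otimes> S i \<oplus> \<one>"
  using y_y[of i "Suc i"] by (simp add: S_S)

lemma S_commute: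
  "1 \<le> i \<Longrightarrow> Suc i < j \<Longrightarrow> j < m \<Longrightarrow> S i \<otimes> S j = S j \<otimes> S i"
  using y_y[of i j] by (simp add: S_S)

lemma u_S: "1 \<le> i \<Longrightarrow> i < m \<Longrightarrow> u \<otimes> S i = S i \<otimes> u"
  unfolding S_def by (simp add: m_assoc flip: u_y)

text \<open>
  Conjugation by \<open>u\<close> reverses the order of the factors of \<open>A\<close>.
\<close>

lemma u_A: "u \<otimes> A = B \<otimes> u" and u_B: "u \<otimes> B = A \<otimes> u"
  unfolding A_def B_def
  by (simp_all add: scale_mult_left scale_mult_right m_assoc u_sq)
    (simp add: m_assoc[symmetric] u_sq)

lemma S_mult_A: "1 \<le> i \<Longrightarrow> i < m \<Longrightarrow> S i \<otimes> A = R_s \<star> (y i \<otimes> v 1)"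
  and B_mult_S: "1 \<le> i \<Longrightarrow> i < m \<Longrightarrow> B \<otimes> S i = R_s \<star> (v 1 \<otimes> y i)"
proof -
  assume i: "1 \<le> i" "i < m"
  have "S i \<otimes> A = R_s \<star> (y i \<otimes> (u \<otimes> u) \<otimes> v 1)"
    unfolding S_def A_def using i by (simp add: scale_mult_left scale_mult_right m_assoc u_y)
  then show "S i \<otimes> A = R_s \<star> (y i \<otimes> v 1)" using i by (simp add: u_sq)
  have "B \<otimes> S i = R_s \<star> (v 1 \<otimes> (u \<otimes> u) \<otimes> y i)"
    unfolding S_def B_def using i by (simp add: scale_mult_left scale_mult_right m_assoc)
  then show "B \<otimes> S i = R_s \<star> (v 1 \<otimes> y i)" using i by (simp add: u_sq)
qed

text \<open>
  For \<open>i > 1\<close> the vector \<open>y_i\<close> is orthogonal to \<open>v_1\<close>, so that it commutes with it.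
\<close>

lemma S_A: "2 \<le> i \<Longrightarrow> i < m \<Longrightarrow> S i \<otimes> A = B \<otimes> S i"
  using v_y[of 1 i] m by (simp add: S_mult_A B_mult_S)

lemma S_B: 
  assumes "2 \<le> i" "i < m" shows "S i \<otimes> B = A \<otimes> S i"
proof -
  have [simp]: "S i \<in> carrier K" using assms by simp
  have "S i \<otimes> B = S i \<otimes> B \<otimes> (u \<otimes> u)" by (simp add: u_sq)
  also have "\<dots> = S i \<otimes> (B \<otimes> u) \<otimes> u" by (simp add: m_assoc)
  also have "\<dots> = S i \<otimes> (u \<otimes> A) \<otimes> u" by (simp only: u_A)
  also have "\<dots> = (S i \<otimes> u) \<otimes> A \<otimes> u" by (simp add: m_assoc)
  also have "\<dots> = u \<otimes> (S i \<otimes> A) \<otimes> u" using assms by (simp add: m_assoc u_S[symmetric])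
  also have "\<dots> = (u \<otimes> B) \<otimes> (S i \<otimes> u)" using assms by (simp add: m_assoc S_A)
  also have "\<dots> = A \<otimes> (u \<otimes> u) \<otimes> S i" using assms by (simp add: m_assoc u_S[symmetric] u_B)
  finally show ?thesis by (simp add: u_sq)
qed

lemma A_add_B: "A \<oplus> B = R_s \<star> \<one>"
proof -
  have "A \<oplus> B = R_s \<star> (u \<otimes> v 1 \<oplus> v 1 \<otimes> u)"
    unfolding A_def B_def by (simp add: scale_add_right)
  also have "u \<otimes> v 1 \<oplus> v 1 \<otimes> u = \<one>"
    using m by (simp add: u_v a_ac add_self add_cancel)
  finally show ?thesis .
qed

lemma B_eq: "B = A \<oplus> R_s \<star> \<one>"
  unfolding A_add_B[symmetric] by (simp add: add_cancel)

lemma A_B: "A \<otimes> B = \<one>"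
proof -
  have "A \<otimes> B = (R_s * R_s) \<star> (u \<otimes> (v 1 \<otimes> v 1) \<otimes> u)"
    unfolding A_def B_def by (simp add: scale_mult_left scale_mult_right scale_scale m_assoc)
  also have "\<dots> = (R_s * R_s * R_t_inv) \<star> \<one>"
    using m v_sq[of 1] by (simp add: scale_mult_left scale_mult_right scale_scale u_sq)
  also have "R_s * R_s * R_t_inv = (R_s * R_s_inv) * (R_s * R_s_inv)"
    by (simp add: R_t_inv_def power2_eq_square ac_simps)
  finally show ?thesis by (simp add: R_s_s_inv)
qed

text \<open>
  Although \<open>S_1\<close> does not exchange \<open>A\<close> and \<open>B\<close>, the nilpotent element \<open>1 + S_1\<close> does: the
  additional term \<open>s\<close>, which comes from \<open>y_1 v_1 = v_1 y_1 + 1\<close>, accounts for \<open>A + B = s\<close>.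
\<close>

lemma one_add_S_1_A: "(\<one> \<oplus> S 1) \<otimes> A = B \<otimes> (\<one> \<oplus> S 1)"
proof -
  have "(\<one> \<oplus> S 1) \<otimes> A = A \<oplus> R_s \<star> (v 1 \<otimes> y 1 \<oplus> \<one>)"
    using S_mult_A[of 1] v_y[of 1 1] m by (simp add: l_distr)
  also have "\<dots> = B \<oplus> B \<otimes> S 1"
    using B_mult_S[of 1] m by (simp add: B_eq scale_add_right a_ac)
  also have "\<dots> = B \<otimes> (\<one> \<oplus> S 1)" by (simp add: r_distr)
  finally show ?thesis .
qed

text \<open>
  The element \<open>A\<close> is a root of \<open>(x + \<alpha>)(x + 1/\<alpha>) = x^2 + s x + 1\<close>.
\<close>

lemma w_A: "w \<otimes> A = R_alpha \<star> w"
proof -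
  have "(A \<oplus> R_alpha_inv \<star> \<one>) \<otimes> A = A \<otimes> (B \<oplus> R_s \<star> \<one>) \<oplus> R_alpha_inv \<star> A"
    by (simp add: B_eq l_distr scale_mult_left a_assoc add_self)
  also have "\<dots> = (R_alpha + R_alpha_inv + R_alpha_inv) \<star> A \<oplus> (R_alpha * R_alpha_inv) \<star> \<one>"
    by (simp add: r_distr A_B scale_mult_right scale_add_left R_alpha_alpha_inv R_two a_ac add_self
        flip: R_alpha_plus_alpha_inv)
  also have "\<dots> = R_alpha \<star> (A \<oplus> R_alpha_inv \<star> \<one>)"
    by (simp add: add.assoc R_double scale_add_right scale_scale)
  finally show ?thesis
    unfolding w_def by (simp add: m_assoc scale_mult_right)
qed

lemma w_B: "w \<otimes> B = R_alpha_inv \<star> w"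
proof -
  have "w \<otimes> B = w \<otimes> A \<oplus> R_s \<star> w"
    by (simp add: B_eq r_distr scale_mult_right)
  also have "\<dots> = (R_alpha + R_alpha + R_alpha_inv) \<star> w"
    unfolding w_A
    by (simp add: scale_add_left a_assoc R_two add_cancel flip: R_alpha_plus_alpha_inv)
  finally show ?thesis by (simp add: R_two)
qed

text \<open>
  By \<open>one_add_S_1_A\<close>, the factor \<open>1 + S_1\<close> can be moved to the right end of \<open>w\<close>, where it absorbs \<open>S_1\<close>.
\<close>

lemma w_S_1: "w \<otimes> S 1 = w"
proof -
  have *: "w = (B \<oplus> R_alpha_inv \<star> \<one>) \<otimes> (\<one> \<oplus> S 1)"
    unfolding w_def using one_add_S_1_A
    by (simp add: l_distr r_distr scale_mult_left scale_mult_right scale_add_right a_ac)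
  have "(\<one> \<oplus> S 1) \<otimes> S 1 = \<one> \<oplus> S 1"
    using m S_sq[of 1] by (simp add: l_distr a_comm)
  then show ?thesis unfolding * by (simp add: m_assoc)
qed

lemma w_expand:
  "w = (R_alpha\<^sup>2 * R_s_inv) \<star> \<one> \<oplus> R_alpha \<star> (u \<otimes> v 1) \<oplus> R_alpha_inv \<star> (u \<otimes> v 2) \<oplus>
    R_s \<star> (v 1 \<otimes> v 2)"
proof -
  have [simp]: "v 2 \<in> carrier K" using m by simp
  have s_t: "R_s * R_t_inv = R_s_inv"
    using R_s_s_inv by (metis R_t_inv_def mult.assoc mult_1 power2_eq_square)
  \<comment> \<open>The constant coefficient of \<open>w\<close>: \<open>\<alpha>^2/s = 1/s + \<alpha>\<close>, from the equation of \<open>\<alpha>\<close>.\<close>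
  have "R_alpha\<^sup>2 + 1 = R_alpha\<^sup>2 + 1 + (R_alpha\<^sup>2 + R_s * R_alpha + 1)"
    by (simp add: R_alpha_root)
  also have "\<dots> = R_s * R_alpha + (R_alpha\<^sup>2 + R_alpha\<^sup>2) + (1 + 1)" by (simp add: ac_simps)
  finally have "(R_alpha\<^sup>2 + 1) * R_s_inv = R_s * R_alpha * R_s_inv" by (simp only: R_double add_0_right)
  also have "\<dots> = R_alpha" by (metis R_s_s_inv mult.commute mult.left_commute mult_1)
  finally have "R_alpha\<^sup>2 * R_s_inv + R_s_inv + R_s_inv = R_alpha + R_s_inv"
    by (simp add: distrib_right)
  then have const: "R_alpha\<^sup>2 * R_s_inv = R_s_inv + R_s + R_alpha_inv"
    by (simp add: add.assoc R_double flip: R_alpha_plus_alpha_inv)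
  have "S 1 \<otimes> A = R_s \<star> (v 1 \<otimes> v 1 \<oplus> v 2 \<otimes> v 1)"
    using S_mult_A[of 1] m by (simp add: y_def l_distr numeral_2_eq_2)
  also have "\<dots> = R_s_inv \<star> \<one> \<oplus> R_s \<star> (v 1 \<otimes> v 2) \<oplus> R_s \<star> \<one>"
    using m v_sq[of 1] v_v[of 2 1] by (simp add: scale_add_right scale_scale s_t a_ac)
  finally have SA: "S 1 \<otimes> A = R_s_inv \<star> \<one> \<oplus> R_s \<star> (v 1 \<otimes> v 2) \<oplus> R_s \<star> \<one>" .
  have S1: "S 1 = u \<otimes> v 1 \<oplus> u \<otimes> v 2"
    unfolding S_def y_def using m by (simp add: r_distr numeral_2_eq_2)
  have "w = A \<oplus> S 1 \<otimes> A \<oplus> R_alpha_inv \<star> (\<one> \<oplus> S 1)"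
    unfolding w_def by (simp add: l_distr r_distr scale_mult_right scale_add_right a_ac)
  also have "\<dots> = (R_s_inv + R_s + R_alpha_inv) \<star> \<one> \<oplus> (R_s + R_alpha_inv) \<star> (u \<otimes> v 1) \<oplus>
      R_alpha_inv \<star> (u \<otimes> v 2) \<oplus> R_s \<star> (v 1 \<otimes> v 2)"
    unfolding SA unfolding S1 unfolding A_def by (simp add: scale_add_left scale_add_right a_ac)
  also have "R_s + R_alpha_inv = R_alpha"
    by (simp add: add.assoc R_double flip: R_alpha_plus_alpha_inv)
  finally show ?thesis unfolding const .
qed


section \<open>The action on the doubled lists\<close>

primrec X :: "nat \<Rightarrow> 'a list" where
  "X 0 = [w]"
| "X (Suc k) = X k @ map (\<lambda>x. x \<otimes> S (m - Suc k)) (X k)"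

lemma length_X [simp]: "length (X k) = 2 ^ k"
  by (induction k) auto

lemma X_closed: "k \<le> m - 2 \<Longrightarrow> set (X k) \<subseteq> carrier K"
proof (induction k)
  case (Suc k)
  then have "S (m - Suc k) \<in> carrier K" by (intro S_closed) auto
  with Suc show ?case by (auto simp: subset_eq)
qed simp

lemma acts_by_singleton: "x \<in> carrier K \<Longrightarrow> x \<otimes> g = c \<star> x \<Longrightarrow> acts_by [x] g (mat 1 1 (\<lambda>_. c))"
  by (simp add: acts_by_def lincomb_def lessThan_Suc)

text \<open>
  Before the last doubling, only generators commuting with \<open>S_1\<close> have been used.
\<close>

lemma X_S_1: "k \<le> m - 3 \<Longrightarrow> x \<in> set (X k) \<Longrightarrow> x \<otimes> S 1 = x"
proof (induction k arbitrary: x)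
  case 0
  then show ?case using w_S_1 by simp
next
  case (Suc k)
  show ?case
  proof (cases "x \<in> set (X k)")
    case False
    then obtain z where z: "z \<in> set (X k)" and x: "x = z \<otimes> S (m - Suc k)" using Suc.prems by auto
    have zc: "z \<in> carrier K" using z subsetD[OF X_closed[of k]] Suc.prems(1) by simp
    have "S 1 \<otimes> S (m - Suc k) = S (m - Suc k) \<otimes> S 1" using Suc.prems by (intro S_commute) auto
    then have "x \<otimes> S 1 = z \<otimes> S 1 \<otimes> S (m - Suc k)"
      unfolding x using zc Suc.prems m by (simp add: m_assoc)
    then show ?thesis using Suc z x by simp
  qed (use Suc in auto)
qed

text \<open>
  The action of \<open>B\<close> has to be carried along, since each doubling exchanges \<open>A\<close> and \<open>B\<close> on the new half; it
  produces the inverse in the recursion for \<open>a^(m)\<close>.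
\<close>

lemma X_acts_A_B:
  assumes "k < m - 2"
  shows "eta_a (k + 3) \<in> Units (Mat_ring (2 ^ Suc k)) \<and> acts_by (X (Suc k)) A (eta_a (k + 3)) \<and>
    acts_by (X (Suc k)) B (inv\<^bsub>Mat_ring (2 ^ Suc k)\<^esub> (eta_a (k + 3)))"
  using assms
proof (induction k)
  case 0
  have h: "S (m - Suc 0) \<in> carrier K" "S (m - Suc 0) \<otimes> A = B \<otimes> S (m - Suc 0)"
    "S (m - Suc 0) \<otimes> B = A \<otimes> S (m - Suc 0)"
    using m by (auto intro!: S_A S_B)
  have A: "acts_by [w] A (mat 1 1 (\<lambda>_. R_alpha))" and B: "acts_by [w] B (mat 1 1 (\<lambda>_. R_alpha_inv))"
    by (intro acts_by_singleton w_A w_B w_closed)+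
  show ?case
    using acts_by_double_twisted[of "[w]" 1, OF _ _ h(1) A_closed B_closed h(2) A B]
      acts_by_double_twisted[of "[w]" 1, OF _ _ h(1) B_closed A_closed h(3) B A]
      Units_diag_inv[OF Units_scalar_mat(1)[OF R_alpha_alpha_inv]]
    unfolding Units_scalar_mat(2)[OF R_alpha_alpha_inv]
    by (simp add: eta_a_3 numeral_2_eq_2)
next
  case (Suc k)
  let ?n = "2 ^ Suc k :: nat" and ?P = "eta_a (k + 3)"
  have h: "S (m - Suc (Suc k)) \<in> carrier K"
    "S (m - Suc (Suc k)) \<otimes> A = B \<otimes> S (m - Suc (Suc k))"
    "S (m - Suc (Suc k)) \<otimes> B = A \<otimes> S (m - Suc (Suc k))"
    using Suc.prems by (auto intro!: S_A S_B S_closed)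
  have X: "set (X (Suc k)) \<subseteq> carrier K" "length (X (Suc k)) = ?n"
    using Suc.prems by (auto intro!: X_closed simp del: X.simps)
  from Suc have IH: "?P \<in> Units (Mat_ring ?n)" "acts_by (X (Suc k)) A ?P"
    "acts_by (X (Suc k)) B (inv\<^bsub>Mat_ring ?n\<^esub> ?P)" by auto
  have eta: "eta_a (Suc k + 3) = four_block_mat ?P (0\<^sub>m ?n ?n) (0\<^sub>m ?n ?n) (inv\<^bsub>Mat_ring ?n\<^esub> ?P)"
    by (subst eta_a.simps) (simp add: Let_def add.commute[of 3 k])
  have n: "2 ^ Suc (Suc k) = ?n + ?n" by simp
  show ?case
    unfolding X.simps(2)[of "Suc k"] n eta Units_diag_inv(2)[OF IH(1)]
    using Units_diag_inv(1)[OF IH(1)]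
      acts_by_double_twisted[OF X h(1) A_closed B_closed h(2) IH(2,3)]
      acts_by_double_twisted[OF X h(1) B_closed A_closed h(3) IH(3,2)] by blast
qed

text \<open>
  With respect to \<open>X k\<close> the element \<open>S j\<close> has the matrix prescribed for the index \<open>j + k + 2 - m\<close>
  in level \<open>k + 2\<close>: the last doubling is by \<open>S (m - k)\<close>, which has to become the index 2.
\<close>

lemma X_acts_S:
  assumes "k < m - 2" "m - Suc k \<le> j" "j < m"
  shows "acts_by (X (Suc k)) (S j) (eta_s (k + 3) (j + k + 3 - m))"
  using assms
proof (induction k arbitrary: j)
  case 0
  then have "j = m - Suc 0" by simp
  moreover have "acts_by ([w] @ map (\<lambda>x. x \<otimes> S j) [w]) (S j)
      (four_block_mat (0\<^sub>m 1 1) (1\<^sub>m 1) (1\<^sub>m 1) (0\<^sub>m 1 1))"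
    using 0 m by (intro acts_by_double_self S_sq) auto
  ultimately show ?case using m by (simp add: eta_s_2)
next
  case (Suc k)
  let ?n = "2 ^ Suc k :: nat" and ?h = "S (m - Suc (Suc k))"
  have h: "?h \<in> carrier K" using Suc.prems by (intro S_closed) auto
  have X: "set (X (Suc k)) \<subseteq> carrier K" "length (X (Suc k)) = ?n"
    using Suc.prems by (auto intro!: X_closed simp del: X.simps)
  have Sj: "S j \<in> carrier K" using Suc.prems by (intro S_closed) auto
  consider "j = m - Suc (Suc k)" | "j = m - Suc k" | "m - Suc k < j" using Suc.prems by linarith
  then show ?case
  proof cases
    case 1
    have "j + Suc k + 3 - m = 2" using 1 Suc.prems by simp
    moreover have "?h \<otimes> ?h = \<one>" using Suc.prems by (intro S_sq) auto
    ultimately show ?thesis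
      using acts_by_double_self[OF X h] 1 eta_s_2[of "Suc k + 3"] by (simp del: power_Suc)
  next
    case 2
    have idx: "j + Suc k + 3 - m = 3" "j + k + 3 - m = 2" using 2 Suc.prems by simp_all
    have "?h \<otimes> S j = S j \<otimes> ?h \<oplus> \<one>"
      using S_braid[of "m - Suc (Suc k)"] 2 Suc.prems by (simp add: Suc_diff_Suc)
    from acts_by_double_braided[OF X h Sj this] Suc.IH[of j] 2 Suc.prems
    have "acts_by (X (Suc (Suc k))) (S j)
        (four_block_mat (eta_s (k + 3) 2) (0\<^sub>m ?n ?n) (1\<^sub>m ?n) (eta_s (k + 3) 2))"
      unfolding idx by simp
    moreover have "eta_s (Suc k + 3) 3 =
        four_block_mat (eta_s (k + 3) 2) (0\<^sub>m ?n ?n) (1\<^sub>m ?n) (eta_s (k + 3) 2)"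
      by (subst eta_s.simps) (simp add: Let_def add.commute[of 3 k])
    ultimately show ?thesis unfolding idx by simp
  next
    case 3
    let ?i = "j + k + 3 - m"
    have idx: "j + Suc k + 3 - m = Suc ?i" "3 \<le> ?i" using 3 Suc.prems by simp_all
    have "?h \<otimes> S j = S j \<otimes> ?h" using 3 Suc.prems by (intro S_commute) auto
    from acts_by_double_twisted[OF X h Sj Sj this] Suc.IH[of j] 3 Suc.prems
    have "acts_by (X (Suc (Suc k))) (S j)
        (four_block_mat (eta_s (k + 3) ?i) (0\<^sub>m ?n ?n) (0\<^sub>m ?n ?n) (eta_s (k + 3) ?i))"
      by simp
    moreover have "eta_s (Suc k + 3) (Suc ?i) =
        four_block_mat (eta_s (k + 3) ?i) (0\<^sub>m ?n ?n) (0\<^sub>m ?n ?n) (eta_s (k + 3) ?i)"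
      using idx(2) by (subst eta_s.simps) (auto simp: Let_def add.commute[of 3 k])
    ultimately show ?thesis unfolding idx(1) by simp
  qed
qed

lemma X_acts_S_1: "acts_by (X (m - 2)) (S 1) (eta_s m 1)"
proof -
  let ?k = "m - 3" and ?n = "2 ^ (m - 3) :: nat"
  have k: "m - 2 = Suc ?k" "m - Suc ?k = 2" using m by simp_all
  have X: "set (X ?k) \<subseteq> carrier K" "length (X ?k) = ?n" using X_closed[of ?k] by simp_all
  have S2: "S 2 \<in> carrier K" "S 2 \<otimes> S 1 = S 1 \<otimes> S 2 \<oplus> \<one>"
    using m S_braid[of 1] by (simp_all add: numeral_2_eq_2 a_assoc add_self)
  have "acts_by (X ?k) (S 1) (1\<^sub>m ?n)"
    using acts_by_fixed[OF X(1)] X_S_1 X(2) by force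
  with acts_by_double_braided[OF X S2(1) _ S2(2)] show ?thesis
    unfolding k(1) X.simps(2) k(2) eta_s_1[OF m] by simp
qed

lemma X_acts:
  shows "eta_a m \<in> Units (Mat_ring (2 ^ (m - 2)))"
    and "acts_by (X (m - 2)) A (eta_a m)"
    and "acts_by (X (m - 2)) B (inv\<^bsub>Mat_ring (2 ^ (m - 2))\<^esub> (eta_a m))"
    and "1 \<le> i \<Longrightarrow> i < m \<Longrightarrow> acts_by (X (m - 2)) (S i) (eta_s m i)"
proof -
  have k: "Suc (m - 3) = m - 2" "m - 3 + 3 = m" using m by simp_all
  show "eta_a m \<in> Units (Mat_ring (2 ^ (m - 2)))" "acts_by (X (m - 2)) A (eta_a m)"
    "acts_by (X (m - 2)) B (inv\<^bsub>Mat_ring (2 ^ (m - 2))\<^esub> (eta_a m))"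
    using X_acts_A_B[of "m - 3"] m unfolding k by simp_all
  assume i: "1 \<le> i" "i < m"
  show "acts_by (X (m - 2)) (S i) (eta_s m i)"
  proof (cases "i = 1")
    case False
    then show ?thesis using X_acts_S[of "m - 3" i] m i unfolding k by simp
  qed (simp only: X_acts_S_1)
qed

definition L :: "'a list" where
  "L = X (m - 2) @ map (\<lambda>x. x \<otimes> u) (X (m - 2))"

lemma L_closed: "set L \<subseteq> carrier K"
  unfolding L_def using X_closed[of "m - 2"] by auto

lemma L_acts:
  defines "n \<equiv> 2 ^ (m - 2)"
  shows "acts_by L u (four_block_mat (0\<^sub>m n n) (1\<^sub>m n) (1\<^sub>m n) (0\<^sub>m n n))"
    and "acts_by L A (four_block_mat (eta_a m) (0\<^sub>m n n) (0\<^sub>m n n) (inv\<^bsub>Mat_ring n\<^esub> (eta_a m)))"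
    and "1 \<le> i \<Longrightarrow> i < m \<Longrightarrow>
      acts_by L (S i) (four_block_mat (eta_s m i) (0\<^sub>m n n) (0\<^sub>m n n) (eta_s m i))"
proof -
  have X: "set (X (m - 2)) \<subseteq> carrier K" "length (X (m - 2)) = n"
    by (simp_all add: X_closed n_def)
  show "acts_by L u (four_block_mat (0\<^sub>m n n) (1\<^sub>m n) (1\<^sub>m n) (0\<^sub>m n n))"
    unfolding L_def by (rule acts_by_double_self[OF X u u_sq])
  show "acts_by L A (four_block_mat (eta_a m) (0\<^sub>m n n) (0\<^sub>m n n) (inv\<^bsub>Mat_ring n\<^esub> (eta_a m)))"
    unfolding L_def n_def
    by (rule acts_by_double_twisted[OF X[unfolded n_def] u A_closed B_closed u_A X_acts(2,3)])
  assume i: "1 \<le> i" "i < m"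
  show "acts_by L (S i) (four_block_mat (eta_s m i) (0\<^sub>m n n) (0\<^sub>m n n) (eta_s m i))"
    unfolding L_def
    by (rule acts_by_double_twisted[OF X u S_closed S_closed u_S X_acts(4) X_acts(4)]) (use i in auto)
qed

lemma span_L_right_u: "x \<in> span L \<Longrightarrow> x \<otimes> u \<in> span L"
  by (rule acts_by_span[OF L_closed u L_acts(1)])

text \<open>
  The vector \<open>v_1\<close> is \<open>s^-1 u A\<close>, and \<open>v_{i+1} = v_i + u S_i\<close>.
\<close>

lemma span_L_right_v:
  assumes "x \<in> span L" "1 \<le> i" "i \<le> m"
  shows "x \<otimes> v i \<in> span L"
  using assms(2,3)
proof (induction i rule: dec_induct)
  case base
  have x: "x \<in> carrier K" using assms(1) span_closed[OF L_closed] by blast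
  have "R_s_inv \<star> ((x \<otimes> u) \<otimes> A) \<in> span L"
    by (intro span_scale[OF L_closed] acts_by_span[OF L_closed A_closed L_acts(2)] span_L_right_u assms(1))
  also have "R_s_inv \<star> ((x \<otimes> u) \<otimes> A) = (R_s * R_s_inv) \<star> (x \<otimes> (u \<otimes> u) \<otimes> v 1)"
    unfolding A_def using x by (simp add: scale_mult_right scale_mult_left scale_scale m_assoc mult.commute)
  finally show ?case using x by (simp add: u_sq R_s_s_inv)
next
  case (step i)
  have x: "x \<in> carrier K" using assms(1) span_closed[OF L_closed] by blast
  have i: "1 \<le> i" "i < m" using step by auto
  have "(x \<otimes> u) \<otimes> S i = x \<otimes> (u \<otimes> u) \<otimes> y i"
    unfolding S_def using x i by (simp add: m_assoc)
  then have "x \<otimes> v (Suc i) = x \<otimes> v i \<oplus> (x \<otimes> u) \<otimes> S i"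
    using x i by (simp add: u_sq y_def r_distr add_cancel)
  also have "\<dots> \<in> span L"
    using step i
    by (intro span_add[OF L_closed] acts_by_span[OF L_closed S_closed L_acts(3)] span_L_right_u assms(1)) auto
  finally show ?case .
qed

end

section \<open>The algebra of the quadratic module\<close>

lemma poly_mapping_sum_singles:
  "p = (\<Sum>k\<in>Poly_Mapping.keys p. Poly_Mapping.single k (Poly_Mapping.lookup p k))"
  by (rule poly_mapping_eqI)
    (auto simp: lookup_sum lookup_single when_def sum.delta in_keys_iff)

lemma ta_scalar_commute: "ta_scalar r * p = p * ta_scalar r"
proof -
  have "ta_scalar r * Poly_Mapping.single k c = Poly_Mapping.single k c * ta_scalar r" for k c
    by (simp add: ta_scalar_def mult_single mult.commute)
  then show ?thesis
    by (subst (1 2) poly_mapping_sum_singles[of p]) (simp add: sum_distrib_left sum_distrib_right)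
qed

abbreviation cl_class :: "nat \<Rightarrow> free_alg \<Rightarrow> cl_elem" where
  "cl_class m p \<equiv> cl_ideal m +>\<^bsub>tensor_alg m\<^esub> p"

lemma cl_class_ring_hom: "cl_class m \<in> Ring.ring_hom (tensor_alg m) (Cl m)"
  unfolding Cl_def by (rule ideal.rcos_ring_hom[OF cl_ideal_ideal])

lemma cl_class_closed: "p \<in> carrier (tensor_alg m) \<Longrightarrow> cl_class m p \<in> carrier (Cl m)"
  by (rule Ring.ring_hom_closed[OF cl_class_ring_hom])

lemma cl_class_mult:
  "p \<in> carrier (tensor_alg m) \<Longrightarrow> q \<in> carrier (tensor_alg m) \<Longrightarrow>
    cl_class m p \<otimes>\<^bsub>Cl m\<^esub> cl_class m q = cl_class m (p * q)"
  using Ring.ring_hom_mult[OF cl_class_ring_hom, of p m q] by (simp add: tensor_alg_simps)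

lemma cl_class_add:
  "p \<in> carrier (tensor_alg m) \<Longrightarrow> q \<in> carrier (tensor_alg m) \<Longrightarrow>
    cl_class m p \<oplus>\<^bsub>Cl m\<^esub> cl_class m q = cl_class m (p + q)"
  using Ring.ring_hom_add[OF cl_class_ring_hom, of p m q] by (simp add: tensor_alg_simps)

lemma cl_class_one: "cl_class m 1 = \<one>\<^bsub>Cl m\<^esub>"
  using Ring.ring_hom_one[OF cl_class_ring_hom, of m] by (simp add: tensor_alg_simps)

lemma cl_class_zero: "cl_class m 0 = \<zero>\<^bsub>Cl m\<^esub>"
  using Ring.ring_hom_zero[OF cl_class_ring_hom tensor_alg_ring Cl_ring, of m] by (simp add: tensor_alg_simps)

lemma carrier_Cl: "carrier (Cl m) = cl_class m ` carrier (tensor_alg m)"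
  unfolding Cl_def FactRing_def A_RCOSETS_def' by auto

lemma tensor_alg_minus:
  assumes "p \<in> carrier (tensor_alg m)" "q \<in> carrier (tensor_alg m)"
  shows "p \<ominus>\<^bsub>tensor_alg m\<^esub> q = p - q"
proof -
  interpret ring "tensor_alg m" by (rule tensor_alg_ring)
  have "\<ominus>\<^bsub>tensor_alg m\<^esub> q = - q"
    using assms(2) tensor_alg_uminus_closed[OF assms(2)]
    by (intro minus_equality) (auto simp: tensor_alg_simps(3,5))
  then show ?thesis by (simp add: a_minus_def tensor_alg_simps(3))
qed

lemma cl_class_eq_iff:
  assumes "p \<in> carrier (tensor_alg m)" "q \<in> carrier (tensor_alg m)"
  shows "cl_class m p = cl_class m q \<longleftrightarrow> p - q \<in> cl_ideal m"
proof -
  interpret T: ring "tensor_alg m" by (rule tensor_alg_ring)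
  show ?thesis
    using T.quotient_eq_iff_same_a_r_cos[OF cl_ideal_ideal assms] tensor_alg_minus[OF assms] by simp
qed

interpretation Cl: scalar_algebra "Cl m" "cl_scale m" for m
proof (rule scalar_algebra.intro[OF Cl_ring], unfold_locales)
  interpret Cl: ring "Cl m" by (rule Cl_ring)
  note ta_scalar_closed[simp] cl_class_closed[simp]
  have c: "cl_class m (ta_scalar r) \<in> carrier (Cl m)" for r by simp
  fix x assume x: "x \<in> carrier (Cl m)"
  then show "cl_scale m r x \<in> carrier (Cl m)" for r using c by (simp add: cl_scale_def)
  have "ta_scalar (r + s) = ta_scalar r + ta_scalar s" for r s
    by (simp add: ta_scalar_def single_add)
  then show "cl_scale m (r + s) x = cl_scale m r x \<oplus>\<^bsub>Cl m\<^esub> cl_scale m s x" for r s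
    using x c by (simp add: cl_scale_def Cl.l_distr flip: cl_class_add)
  have "ta_scalar (r * s) = ta_scalar r * ta_scalar s" for r s
    by (simp add: ta_scalar_def mult_single)
  then show "cl_scale m r (cl_scale m s x) = cl_scale m (r * s) x" for r s
    using x c by (simp add: cl_scale_def Cl.m_assoc flip: cl_class_mult)
  have "ta_scalar 1 = 1" by (simp add: ta_scalar_def)
  then show "cl_scale m 1 x = x" using x by (simp add: cl_scale_def cl_class_one)
  fix y assume y: "y \<in> carrier (Cl m)"
  show "cl_scale m r (x \<oplus>\<^bsub>Cl m\<^esub> y) = cl_scale m r x \<oplus>\<^bsub>Cl m\<^esub> cl_scale m r y" for r
    using x y c by (simp add: cl_scale_def Cl.r_distr)
  show "cl_scale m r x \<otimes>\<^bsub>Cl m\<^esub> y = cl_scale m r (x \<otimes>\<^bsub>Cl m\<^esub> y)" for r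
    using x y c by (simp add: cl_scale_def Cl.m_assoc)
  show "x \<otimes>\<^bsub>Cl m\<^esub> cl_scale m r y = cl_scale m r (x \<otimes>\<^bsub>Cl m\<^esub> y)" for r
  proof -
    obtain p where p: "p \<in> carrier (tensor_alg m)" "x = cl_class m p" using x carrier_Cl by auto
    have "x \<otimes>\<^bsub>Cl m\<^esub> cl_class m (ta_scalar r) = cl_class m (ta_scalar r) \<otimes>\<^bsub>Cl m\<^esub> x"
      unfolding p(2) using p(1) by (simp add: cl_class_mult ta_scalar_commute)
    then show ?thesis
      using x y c by (simp add: cl_scale_def flip: Cl.m_assoc)
  qed
qed

lemma cl_lincomb_eq: "cl_lincomb m c xs = Cl.lincomb m c xs"
  by (simp add: cl_lincomb_def Cl.lincomb_def)

lemma cl_span_eq: "cl_span m xs = Cl.span m xs"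
  by (simp add: cl_span_def Cl.span_def cl_lincomb_eq)

lemma cl_indep_eq: "cl_indep m xs \<longleftrightarrow> Cl.indep m xs"
  by (simp add: cl_indep_def Cl.indep_def cl_lincomb_eq)

lemma right_mult_matrix_eq: "right_mult_matrix m xs g P \<longleftrightarrow> Cl.acts_by m xs g P"
  by (simp add: right_mult_matrix_def Cl.acts_by_def cl_lincomb_eq)

lemma cl_vec_closed [simp]: "cl_vec m x \<in> carrier (Cl m)"
  by (simp add: cl_vec_def cl_class_closed ta_vec_closed)

lemma cl_scale_class:
  "p \<in> carrier (tensor_alg m) \<Longrightarrow> cl_scale m r (cl_class m p) = cl_class m (ta_scalar r * p)"
  by (simp add: cl_scale_def cl_class_mult ta_scalar_closed)

lemma cl_vec_add:
  assumes "x \<in> carrier_vec (m + 1)" "y \<in> carrier_vec (m + 1)"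
  shows "cl_vec m (x + y) = cl_vec m x \<oplus>\<^bsub>Cl m\<^esub> cl_vec m y"
proof -
  have "ta_vec m (x + y) = ta_vec m x + ta_vec m y"
    unfolding ta_vec_def sum.distrib[symmetric] using assms
    by (intro sum.cong) (auto simp: single_add)
  then show ?thesis by (simp add: cl_vec_def cl_class_add ta_vec_closed)
qed

lemma cl_vec_sq:
  assumes "x \<in> carrier_vec (m + 1)"
  shows "cl_vec m x \<otimes>\<^bsub>Cl m\<^esub> cl_vec m x = cl_scale m (V_q m x) \<one>\<^bsub>Cl m\<^esub>"
proof -
  interpret T: ring "tensor_alg m" by (rule tensor_alg_ring)
  have gen: "ta_vec m y * ta_vec m y - ta_scalar (V_q m y) \<in> carrier (tensor_alg m)" for y
    using tensor_alg_add_closed[OF tensor_alg_mult_closed[OF ta_vec_closed ta_vec_closed]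
        tensor_alg_uminus_closed[OF ta_scalar_closed], of m y y "V_q m y"] by simp
  have "ta_vec m x * ta_vec m x - ta_scalar (V_q m x) \<in> cl_ideal m"
    unfolding cl_ideal_def using gen assms by (intro subsetD[OF T.genideal_self]) auto
  then have "cl_class m (ta_vec m x * ta_vec m x) = cl_class m (ta_scalar (V_q m x))"
    by (subst cl_class_eq_iff) (auto intro: tensor_alg_mult_closed ta_vec_closed ta_scalar_closed)
  then show ?thesis
    by (simp add: cl_vec_def cl_class_mult ta_vec_closed cl_scale_def cl_class_closed ta_scalar_closed)
qed

text \<open>
  Polarisation of \<open>x^2 = q(x)\<close>.
\<close>

lemma cl_vec_anticommute:
  assumes "x \<in> carrier_vec (m + 1)" "y \<in> carrier_vec (m + 1)"
  shows "cl_vec m x \<otimes>\<^bsub>Cl m\<^esub> cl_vec m y =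
    cl_vec m y \<otimes>\<^bsub>Cl m\<^esub> cl_vec m x \<oplus>\<^bsub>Cl m\<^esub> cl_scale m (V_bil m x y) \<one>\<^bsub>Cl m\<^esub>"
proof -
  let ?x = "cl_vec m x" and ?y = "cl_vec m y" and ?s = "\<lambda>r. cl_scale m r \<one>\<^bsub>Cl m\<^esub>"
  have double: "z \<oplus>\<^bsub>Cl m\<^esub> z = \<zero>\<^bsub>Cl m\<^esub>" if "z \<in> carrier (Cl m)" for z
    using Cl.scale_add_left[of z m 1 1] that by (simp add: R_two)
  have cancel: "z \<oplus>\<^bsub>Cl m\<^esub> (z \<oplus>\<^bsub>Cl m\<^esub> z') = z'" if "z \<in> carrier (Cl m)" "z' \<in> carrier (Cl m)" for z z'
    using that by (simp add: double flip: Cl.a_assoc)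
  have "(?x \<oplus>\<^bsub>Cl m\<^esub> ?y) \<otimes>\<^bsub>Cl m\<^esub> (?x \<oplus>\<^bsub>Cl m\<^esub> ?y) = ?s (V_q m (x + y))"
    using assms by (simp add: cl_vec_sq flip: cl_vec_add)
  also have "\<dots> = ?s (V_bil m x y) \<oplus>\<^bsub>Cl m\<^esub> (?x \<otimes>\<^bsub>Cl m\<^esub> ?x \<oplus>\<^bsub>Cl m\<^esub> ?y \<otimes>\<^bsub>Cl m\<^esub> ?y)"
    using assms by (simp add: V_q_add cl_vec_sq Cl.scale_add_left Cl.a_ac)
  finally have *: "(?x \<otimes>\<^bsub>Cl m\<^esub> ?x \<oplus>\<^bsub>Cl m\<^esub> ?y \<otimes>\<^bsub>Cl m\<^esub> ?y) \<oplus>\<^bsub>Cl m\<^esub>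
      (?y \<otimes>\<^bsub>Cl m\<^esub> ?x \<oplus>\<^bsub>Cl m\<^esub> ?x \<otimes>\<^bsub>Cl m\<^esub> ?y) =
      (?x \<otimes>\<^bsub>Cl m\<^esub> ?x \<oplus>\<^bsub>Cl m\<^esub> ?y \<otimes>\<^bsub>Cl m\<^esub> ?y) \<oplus>\<^bsub>Cl m\<^esub> ?s (V_bil m x y)"
    by (simp add: Cl.l_distr Cl.r_distr Cl.a_ac)
  have "?y \<otimes>\<^bsub>Cl m\<^esub> ?x \<oplus>\<^bsub>Cl m\<^esub> ?x \<otimes>\<^bsub>Cl m\<^esub> ?y = ?s (V_bil m x y)"
    using arg_cong[OF *, of "\<lambda>z. (?x \<otimes>\<^bsub>Cl m\<^esub> ?x \<oplus>\<^bsub>Cl m\<^esub> ?y \<otimes>\<^bsub>Cl m\<^esub> ?y) \<oplus>\<^bsub>Cl m\<^esub> z"]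
    by (subst (asm) (1 2) cancel) auto
  then show ?thesis using cancel[of "?y \<otimes>\<^bsub>Cl m\<^esub> ?x" "?x \<otimes>\<^bsub>Cl m\<^esub> ?y"] by simp
qed

lemma Cl_clifford_generators:
  assumes "3 \<le> m"
  shows "clifford_generators (Cl m) (cl_scale m) m (cl_vec m (V_u m)) (\<lambda>i. cl_vec m (V_v m i))"
proof (intro clifford_generators.intro Cl.scalar_algebra_axioms clifford_generators_axioms.intro assms)
  have u: "V_u m = unit_vec (m + 1) 0" and v: "V_v m i = unit_vec (m + 1) i" for i
    by (simp_all add: V_u_def V_v_def)
  have q: "cl_vec m (unit_vec (m + 1) i) \<otimes>\<^bsub>Cl m\<^esub> cl_vec m (unit_vec (m + 1) i) =
      cl_scale m (if i = 0 then 1 else R_t_inv) \<one>\<^bsub>Cl m\<^esub>" if "i \<le> m" for i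
    using that V_q_basis[of i m] by (simp add: cl_vec_sq)
  have b: "cl_vec m (unit_vec (m + 1) i) \<otimes>\<^bsub>Cl m\<^esub> cl_vec m (unit_vec (m + 1) j) =
      cl_vec m (unit_vec (m + 1) j) \<otimes>\<^bsub>Cl m\<^esub> cl_vec m (unit_vec (m + 1) i) \<oplus>\<^bsub>Cl m\<^esub> \<one>\<^bsub>Cl m\<^esub>"
    if "i \<le> m" "j \<le> m" "i \<noteq> j" for i j
    using that V_bil_basis[of i m j] cl_vec_anticommute[of "unit_vec (m + 1) i" m "unit_vec (m + 1) j"]
    by simp
  show "cl_vec m (V_u m) \<otimes>\<^bsub>Cl m\<^esub> cl_vec m (V_u m) = \<one>\<^bsub>Cl m\<^esub>"
    unfolding u using q[of 0] by simp
  fix i assume i: "1 \<le> i" "i \<le> m"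
  show "cl_vec m (V_v m i) \<otimes>\<^bsub>Cl m\<^esub> cl_vec m (V_v m i) = cl_scale m R_t_inv \<one>\<^bsub>Cl m\<^esub>"
    unfolding v using q[of i] i by simp
  show "cl_vec m (V_u m) \<otimes>\<^bsub>Cl m\<^esub> cl_vec m (V_v m i) =
      cl_vec m (V_v m i) \<otimes>\<^bsub>Cl m\<^esub> cl_vec m (V_u m) \<oplus>\<^bsub>Cl m\<^esub> \<one>\<^bsub>Cl m\<^esub>"
    unfolding u v by (rule b) (use i in auto)
  fix j assume j: "1 \<le> j" "j \<le> m" "i \<noteq> j"
  show "cl_vec m (V_v m i) \<otimes>\<^bsub>Cl m\<^esub> cl_vec m (V_v m j) =
      cl_vec m (V_v m j) \<otimes>\<^bsub>Cl m\<^esub> cl_vec m (V_v m i) \<oplus>\<^bsub>Cl m\<^esub> \<one>\<^bsub>Cl m\<^esub>"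
    unfolding v by (rule b) (use i j in auto)
qed auto

lemma ta_vec_unit: "i \<le> m \<Longrightarrow> ta_vec m (unit_vec (m + 1) i) = Poly_Mapping.single (FMon [i]) 1"
proof -
  assume i: "i \<le> m"
  have "ta_vec m (unit_vec (m + 1) i) =
      (\<Sum>k\<le>m. if k = i then Poly_Mapping.single (FMon [i]) 1 else 0)"
    unfolding ta_vec_def by (intro sum.cong) (use i in \<open>auto simp: unit_vec_def\<close>)
  then show ?thesis using i by simp
qed

text \<open>
  The algebra is generated by the scalars and the basis vectors, so a submodule that is stable under the
  latter is a right ideal.
\<close>

lemma Cl_right_ideal:
  assumes N: "N \<subseteq> carrier (Cl m)" "\<zero>\<^bsub>Cl m\<^esub> \<in> N"
      "\<And>x y. x \<in> N \<Longrightarrow> y \<in> N \<Longrightarrow> x \<oplus>\<^bsub>Cl m\<^esub> y \<in> N" "\<And>r x. x \<in> N \<Longrightarrow> cl_scale m r x \<in> N"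
    and gens: "\<And>i x. i \<le> m \<Longrightarrow> x \<in> N \<Longrightarrow> x \<otimes>\<^bsub>Cl m\<^esub> cl_vec m (unit_vec (m + 1) i) \<in> N"
    and "x \<in> N" "g \<in> carrier (Cl m)"
  shows "x \<otimes>\<^bsub>Cl m\<^esub> g \<in> N"
proof -
  have single_closed: "Poly_Mapping.single (FMon l) r \<in> carrier (tensor_alg m)"
    if "set l \<subseteq> {..m}" for l r using that by (simp add: tensor_alg_simps)
  have single: "x \<otimes>\<^bsub>Cl m\<^esub> cl_class m (Poly_Mapping.single (FMon l) r) \<in> N" if "set l \<subseteq> {..m}" for l r
    using that
  proof (induction l rule: rev_induct)
    case Nil
    have "x \<otimes>\<^bsub>Cl m\<^esub> cl_class m (ta_scalar r) = cl_scale m r x"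
      using N(1) assms(6) Cl.scale_mult_right[of x m "\<one>\<^bsub>Cl m\<^esub>" r]
      by (auto simp: cl_scale_def cl_class_closed ta_scalar_closed)
    then show ?case using N(4) assms(6) by (simp add: ta_scalar_def zero_free_mon_def)
  next
    case (snoc i l)
    let ?p = "Poly_Mapping.single (FMon l) r"
    have "Poly_Mapping.single (FMon (l @ [i])) r = ?p * ta_vec m (unit_vec (m + 1) i)"
      using snoc.prems ta_vec_unit[of i m] by (simp add: mult_single plus_free_mon_def)
    then have "x \<otimes>\<^bsub>Cl m\<^esub> cl_class m (Poly_Mapping.single (FMon (l @ [i])) r) =
        x \<otimes>\<^bsub>Cl m\<^esub> cl_class m ?p \<otimes>\<^bsub>Cl m\<^esub> cl_vec m (unit_vec (m + 1) i)"
      using N(1) assms(6) snoc.prems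
      by (auto simp: cl_vec_def Cl.m_assoc cl_class_mult cl_class_closed single_closed ta_vec_closed)
    then show ?case using snoc gens by simp
  qed
  obtain p where p: "p \<in> carrier (tensor_alg m)" "g = cl_class m p" using assms(7) carrier_Cl by auto
  let ?q = "\<lambda>k. Poly_Mapping.single k (Poly_Mapping.lookup p k)"
  have q: "?q k \<in> carrier (tensor_alg m)" "x \<otimes>\<^bsub>Cl m\<^esub> cl_class m (?q k) \<in> N"
    if "k \<in> Poly_Mapping.keys p" for k
    using that p(1) single_closed[of "letters k"] single[of "letters k"]
    by (auto simp: tensor_alg_simps)
  have "sum ?q J \<in> carrier (tensor_alg m) \<and> x \<otimes>\<^bsub>Cl m\<^esub> cl_class m (sum ?q J) \<in> N"
    if "finite J" "J \<subseteq> Poly_Mapping.keys p" for J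
    using that
  proof (induction J rule: finite_induct)
    case empty
    then show ?case using N(1,2) assms(6) by (auto simp: tensor_alg_simps cl_class_zero)
  next
    case (insert k J)
    then have J: "sum ?q J \<in> carrier (tensor_alg m)" "x \<otimes>\<^bsub>Cl m\<^esub> cl_class m (sum ?q J) \<in> N"
      and k: "k \<in> Poly_Mapping.keys p" by auto
    have "x \<otimes>\<^bsub>Cl m\<^esub> cl_class m (?q k + sum ?q J) \<in> N"
      using q[OF k] J N(1,3) assms(6)
      by (auto simp: Cl.r_distr cl_class_closed simp flip: cl_class_add)
    then show ?case using insert.hyps q(1)[OF k] J by (simp add: tensor_alg_add_closed)
  qed
  from this[of "Poly_Mapping.keys p"] show ?thesis
    unfolding p(2) by (subst poly_mapping_sum_singles[of p]) simp
qed

section \<open>Modules over the Clifford algebra\<close>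

lemma sum_square_split:
  fixes a :: "nat \<Rightarrow> nat \<Rightarrow> 'a::comm_monoid_add"
  shows "(\<Sum>i\<le>n. \<Sum>j\<le>n. a i j) = (\<Sum>i\<le>n. a i i) + (\<Sum>j\<le>n. \<Sum>i<j. a i j + a j i)"
proof (induction n)
  case (Suc n)
  have "(\<Sum>i\<le>Suc n. \<Sum>j\<le>Suc n. a i j) = (\<Sum>i\<le>n. \<Sum>j\<le>n. a i j) + a (Suc n) (Suc n) +
      (\<Sum>i<Suc n. a i (Suc n) + a (Suc n) i)"
    by (simp only: sum.atMost_Suc sum.distrib lessThan_Suc_atMost) (simp add: ac_simps)
  then show ?case by (simp only: Suc.IH sum.atMost_Suc) (simp add: ac_simps)
qed simp

lemma poly_mapping_additive_induct:
  fixes Q :: "('a \<Rightarrow>\<^sub>0 'b::comm_monoid_add) \<Rightarrow> bool"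
  assumes "\<And>k c. Q (Poly_Mapping.single k c)" "\<And>p q. Q p \<Longrightarrow> Q q \<Longrightarrow> Q (p + q)"
  shows "Q p"
proof -
  have "Q (\<Sum>k\<in>J. Poly_Mapping.single k (Poly_Mapping.lookup p k))" if "finite J" for J
    using that
  proof (induction J rule: finite_induct)
    case empty
    show ?case using assms(1)[of _ 0] by simp
  qed (simp add: assms)
  from this[of "Poly_Mapping.keys p"] show ?thesis
    by (subst poly_mapping_sum_singles[of p]) simp
qed

text \<open>
  A family of operators on functions, one for each basis vector of \<open>V\<close>, that satisfies the Clifford
  relations. It makes the functions a right module, in which a word acts from left to right.
\<close>

locale clifford_module =
  fixes m :: nat and op :: "nat \<Rightarrow> ('p \<Rightarrow> adj_ring) \<Rightarrow> ('p \<Rightarrow> adj_ring)"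
  assumes op_add: "op i (\<lambda>P. f P + g P) = (\<lambda>P. op i f P + op i g P)"
    and op_scale: "op i (\<lambda>P. c * f P) = (\<lambda>P. c * op i f P)"
    and op_sq: "i \<le> m \<Longrightarrow> op i (op i f) P = (if i = 0 then 1 else R_t_inv) * f P"
    and op_anticommute: "i \<le> m \<Longrightarrow> j \<le> m \<Longrightarrow> i \<noteq> j \<Longrightarrow> op i (op j f) P + op j (op i f) P = f P"
begin

lemma op_0: "op i (\<lambda>P. 0) = (\<lambda>P. 0)"
  using op_scale[of i 0] by simp

lemma op_sum: "finite J \<Longrightarrow> op i (\<lambda>P. \<Sum>j\<in>J. c j * g j P) = (\<lambda>P. \<Sum>j\<in>J. c j * op i (g j) P)"
  by (induction J rule: finite_induct) (simp_all add: op_0 op_add op_scale)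

lemma fold_op_add: "fold op l (\<lambda>P. f P + g P) = (\<lambda>P. fold op l f P + fold op l g P)"
  by (induction l arbitrary: f g) (simp_all add: op_add)

lemma fold_op_scale: "fold op l (\<lambda>P. c * f P) = (\<lambda>P. c * fold op l f P)"
  by (induction l arbitrary: f) (simp_all add: op_scale)

definition ev :: "free_alg \<Rightarrow> ('p \<Rightarrow> adj_ring) \<Rightarrow> ('p \<Rightarrow> adj_ring)" where
  "ev p f = (\<lambda>P. \<Sum>k\<in>Poly_Mapping.keys p. Poly_Mapping.lookup p k * fold op (letters k) f P)"

lemma ev_superset:
  assumes "finite J" "Poly_Mapping.keys p \<subseteq> J"
  shows "ev p f P = (\<Sum>k\<in>J. Poly_Mapping.lookup p k * fold op (letters k) f P)"
  unfolding ev_def using assms by (intro sum.mono_neutral_left) (auto simp: in_keys_iff)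

lemma ev_plus: "ev (p + q) f P = ev p f P + ev q f P"
proof -
  let ?J = "Poly_Mapping.keys p \<union> Poly_Mapping.keys q"
  show ?thesis
    using ev_superset[of ?J "p + q" f P] ev_superset[of ?J p f P] ev_superset[of ?J q f P]
      Poly_Mapping.keys_add[of p q]
    by (simp add: lookup_add distrib_right sum.distrib)
qed

lemma ev_single: "ev (Poly_Mapping.single k c) f P = c * fold op (letters k) f P"
  using ev_superset[of "{k}" "Poly_Mapping.single k c" f P] by simp

lemma ev_zero: "ev 0 f P = 0"
  by (simp add: ev_def)

lemma ev_minus: "ev (p - q) f P = ev p f P - ev q f P"
  using ev_plus[of "p - q" q f P] by simp

lemma ev_add: "ev p (\<lambda>P. f P + g P) P = ev p f P + ev p g P"
  by (simp add: ev_def fold_op_add distrib_left sum.distrib)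

lemma ev_scale: "ev p (\<lambda>P. c * f P) P = c * ev p f P"
  by (simp add: ev_def fold_op_scale sum_distrib_left ac_simps)

lemma ev_mult: "ev (p * q) f P = ev q (ev p f) P"
proof (induction p arbitrary: P rule: poly_mapping_additive_induct)
  case (1 k c)
  have single: "ev (Poly_Mapping.single k c) f = (\<lambda>P. c * fold op (letters k) f P)"
    by (rule ext) (rule ev_single)
  show ?case
  proof (induction q arbitrary: P rule: poly_mapping_additive_induct)
    case (1 l d)
    then show ?case
      by (simp add: mult_single single ev_scale) (simp add: ev_single plus_free_mon_def ac_simps)
  next
    case (2 p q)
    then show ?case by (simp add: distrib_left ev_plus)
  qed
next
  case (2 p p')
  have "ev (p + p') f = (\<lambda>P. ev p f P + ev p' f P)" by (rule ext) (rule ev_plus)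
  then show ?case by (simp add: distrib_right ev_plus ev_add 2)
qed

lemma ev_sum: "ev (\<Sum>i\<in>J. p i) f P = (\<Sum>i\<in>J. ev (p i) f P)"
  by (induction J rule: infinite_finite_induct) (simp_all add: ev_zero ev_plus)

lemma ev_vec: "ev (ta_vec m x) f = (\<lambda>P. \<Sum>i\<le>m. x $ i * op i f P)"
  by (rule ext) (simp add: ta_vec_def ev_sum ev_single)

lemma ev_scalar: "ev (ta_scalar r) f P = r * f P"
  by (simp add: ta_scalar_def ev_single zero_free_mon_def)

lemma ev_vec_sq: "ev (ta_vec m x * ta_vec m x) f P = V_q m x * f P"
proof -
  have "ev (ta_vec m x * ta_vec m x) f P = (\<Sum>i\<le>m. \<Sum>j\<le>m. x $ i * x $ j * op i (op j f) P)"
    by (simp add: ev_mult ev_vec op_sum sum_distrib_left ac_simps)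
  also have "\<dots> = (\<Sum>i\<le>m. x $ i * x $ i * op i (op i f) P) +
      (\<Sum>j\<le>m. \<Sum>i<j. x $ i * x $ j * op i (op j f) P + x $ j * x $ i * op j (op i f) P)"
    by (rule sum_square_split)
  also have "(\<Sum>i\<le>m. x $ i * x $ i * op i (op i f) P) =
      (\<Sum>i\<le>m. (if i = 0 then 1 else R_t_inv) * (x $ i)\<^sup>2) * f P"
    unfolding sum_distrib_right by (intro sum.cong refl) (auto simp: op_sq power2_eq_square ac_simps)
  also have "(\<Sum>j\<le>m. \<Sum>i<j. x $ i * x $ j * op i (op j f) P + x $ j * x $ i * op j (op i f) P) =
      (\<Sum>j\<le>m. \<Sum>i<j. x $ i * x $ j) * f P"
    unfolding sum_distrib_right
  proof (rule sum.cong[OF HOL.refl], rule sum.cong[OF HOL.refl])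
    fix j i assume "j \<in> {..m}" "i \<in> {..<j}"
    then have "f P = op i (op j f) P + op j (op i f) P" by (simp add: op_anticommute)
    then show "x $ i * x $ j * op i (op j f) P + x $ j * x $ i * op j (op i f) P = x $ i * x $ j * f P"
      by (simp only: distrib_left mult.commute[of "x $ j" "x $ i"])
  qed
  finally show ?thesis by (simp add: V_q_def distrib_right)
qed

text \<open>
  The elements that act as zero form an ideal of the tensor algebra; it contains \<open>x^2 - q(x)\<close> for every
  vector \<open>x\<close>, hence all of the defining ideal.
\<close>

lemma ev_cl_ideal:
  assumes "p \<in> cl_ideal m"
  shows "ev p f P = 0"
proof -
  interpret T: ring "tensor_alg m" by (rule tensor_alg_ring)
  let ?K = "{p \<in> carrier (tensor_alg m). \<forall>f P. ev p f P = 0}"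
  have "ideal ?K (tensor_alg m)"
  proof (rule idealI[OF tensor_alg_ring])
    show "subgroup ?K (add_monoid (tensor_alg m))"
    proof (rule T.add.subgroupI)
      show "?K \<noteq> {}" using T.zero_closed by (auto simp: tensor_alg_simps(5) ev_zero)
    next
      fix p assume p: "p \<in> ?K"
      have "\<ominus>\<^bsub>tensor_alg m\<^esub> p = 0 - p"
        using tensor_alg_minus[of 0 m p] p T.zero_closed
        by (simp add: T.minus_eq tensor_alg_simps(3,5))
      then show "\<ominus>\<^bsub>tensor_alg m\<^esub> p \<in> ?K"
        using p T.a_inv_closed[of p] ev_minus[of 0 p] by (simp add: ev_zero)
    qed (use T.a_closed in \<open>auto simp: tensor_alg_simps(3) ev_plus\<close>)
  next
    fix p q assume p: "p \<in> ?K" and q: "q \<in> carrier (tensor_alg m)"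
    have "ev p f = (\<lambda>P. 0)" for f using p by auto
    moreover have "ev q (\<lambda>P. 0) P = 0" for P using ev_scale[of q 0] by simp
    ultimately show "q \<otimes>\<^bsub>tensor_alg m\<^esub> p \<in> ?K" "p \<otimes>\<^bsub>tensor_alg m\<^esub> q \<in> ?K"
      using p q tensor_alg_mult_closed by (auto simp: tensor_alg_simps(2) ev_mult)
  qed
  moreover have "ta_vec m x * ta_vec m x - ta_scalar (V_q m x) \<in> ?K" for x
    using tensor_alg_add_closed[OF tensor_alg_mult_closed[OF ta_vec_closed ta_vec_closed]
        tensor_alg_uminus_closed[OF ta_scalar_closed], of m x x "V_q m x"]
    by (simp add: ev_minus ev_vec_sq ev_scalar)
  ultimately have "cl_ideal m \<subseteq> ?K"
    unfolding cl_ideal_def by (intro T.genideal_minimal) auto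
  then show ?thesis using assms by auto
qed

text \<open>
  The action does not depend on the representative, by \<open>ev_cl_ideal\<close>.
\<close>

definition act :: "cl_elem \<Rightarrow> ('p \<Rightarrow> adj_ring) \<Rightarrow> ('p \<Rightarrow> adj_ring)" where
  "act x = ev (SOME p. p \<in> carrier (tensor_alg m) \<and> cl_class m p = x)"

lemma act_class:
  assumes "p \<in> carrier (tensor_alg m)"
  shows "act (cl_class m p) = ev p"
proof (intro ext)
  fix f P
  let ?q = "SOME q. q \<in> carrier (tensor_alg m) \<and> cl_class m q = cl_class m p"
  have "?q \<in> carrier (tensor_alg m) \<and> cl_class m ?q = cl_class m p"
    by (rule someI[of _ p]) (simp add: assms)
  then have "?q - p \<in> cl_ideal m" using assms cl_class_eq_iff by blast
  then show "act (cl_class m p) f P = ev p f P"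
    unfolding act_def using ev_cl_ideal[of "?q - p" f P] by (simp add: ev_minus)
qed

lemma act_add:
  assumes "x \<in> carrier (Cl m)" "y \<in> carrier (Cl m)"
  shows "act (x \<oplus>\<^bsub>Cl m\<^esub> y) f = (\<lambda>P. act x f P + act y f P)"
proof -
  obtain p q where "p \<in> carrier (tensor_alg m)" "q \<in> carrier (tensor_alg m)"
    "x = cl_class m p" "y = cl_class m q" using assms carrier_Cl by auto
  then show ?thesis by (simp add: cl_class_add act_class tensor_alg_add_closed ev_plus fun_eq_iff)
qed

lemma act_mult:
  assumes "x \<in> carrier (Cl m)" "y \<in> carrier (Cl m)"
  shows "act (x \<otimes>\<^bsub>Cl m\<^esub> y) f = act y (act x f)"
proof -
  obtain p q where "p \<in> carrier (tensor_alg m)" "q \<in> carrier (tensor_alg m)"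
    "x = cl_class m p" "y = cl_class m q" using assms carrier_Cl by auto
  then show ?thesis by (simp add: cl_class_mult act_class tensor_alg_mult_closed ev_mult fun_eq_iff)
qed

lemma act_scale:
  assumes "x \<in> carrier (Cl m)"
  shows "act (cl_scale m r x) f = (\<lambda>P. r * act x f P)"
proof -
  obtain p where "p \<in> carrier (tensor_alg m)" "x = cl_class m p" using assms carrier_Cl by auto
  moreover have "ev (ta_scalar r) f = (\<lambda>P. r * f P)" by (rule ext) (rule ev_scalar)
  ultimately have "act (cl_scale m r x) f P = r * act x f P" for P
    by (simp add: cl_scale_class act_class tensor_alg_mult_closed ta_scalar_closed ev_mult ev_scale)
  then show ?thesis by (rule ext)
qed

lemma act_one: "act \<one>\<^bsub>Cl m\<^esub> f = f"
proof -
  have "act \<one>\<^bsub>Cl m\<^esub> f = act (cl_class m (ta_scalar 1)) f"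
    by (simp add: ta_scalar_def cl_class_one)
  also have "\<dots> = f" by (simp add: act_class ta_scalar_closed fun_eq_iff ev_scalar)
  finally show ?thesis .
qed

lemma act_zero: "act \<zero>\<^bsub>Cl m\<^esub> f = (\<lambda>P. 0)"
  using act_scale[of "\<one>\<^bsub>Cl m\<^esub>" 0 f] by simp

lemma act_vec: "i \<le> m \<Longrightarrow> act (cl_vec m (unit_vec (m + 1) i)) f = op i f"
  unfolding cl_vec_def act_class[OF ta_vec_closed]
  using ta_vec_unit[of i m] by (simp add: ev_single fun_eq_iff)

lemma act_lincomb:
  assumes "set xs \<subseteq> carrier (Cl m)"
  shows "act (Cl.lincomb m c xs) f P = (\<Sum>j<length xs. c j * act (xs ! j) f P)"
proof -
  have "(\<Oplus>\<^bsub>Cl m\<^esub>j\<in>J. cl_scale m (c j) (xs ! j)) \<in> carrier (Cl m) \<and>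
      act (\<Oplus>\<^bsub>Cl m\<^esub>j\<in>J. cl_scale m (c j) (xs ! j)) f P = (\<Sum>j\<in>J. c j * act (xs ! j) f P)"
    if "finite J" "J \<subseteq> {..<length xs}" for J
    using that
  proof (induction J rule: finite_induct)
    case (insert i J)
    have c: "xs ! j \<in> carrier (Cl m)" if "j \<in> insert i J" for j
      using that assms insert.prems by (auto simp: subset_eq)
    then show ?case
      using insert by (subst (1 2) Cl.finsum_insert) (auto simp: act_add act_scale)
  qed (simp add: act_zero)
  then show ?thesis unfolding Cl.lincomb_def by blast
qed

definition delta :: "'p \<Rightarrow> 'p \<Rightarrow> adj_ring" where
  "delta E P = (if P = E then 1 else 0)"

text \<open>
  The map \<open>x \<mapsto> f x\<close> is linear, and distinct unit vectors are independent.
\<close>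

lemma indep_if_act_delta:
  assumes xs: "set xs \<subseteq> carrier (Cl m)"
    and delta: "map (\<lambda>x. act x f) xs = map delta Es" and "distinct Es"
  shows "Cl.indep m xs"
  unfolding Cl.indep_def
proof (intro allI impI)
  fix c j assume 0: "Cl.lincomb m c xs = \<zero>\<^bsub>Cl m\<^esub>" and j: "j < length xs"
  have len: "length Es = length xs" using delta by (metis length_map)
  have d: "act (xs ! i) f = delta (Es ! i)" if "i < length xs" for i
    using that delta len by (metis nth_map)
  have "0 = (\<Sum>i<length xs. c i * act (xs ! i) f (Es ! j))"
    using act_lincomb[OF xs, of c f "Es ! j"] 0 by (simp add: act_zero)
  also have "\<dots> = (\<Sum>i<length xs. if i = j then c j else 0)"
    using j len assms(3) by (intro sum.cong refl) (auto simp: d delta_def nth_eq_iff_index_eq)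
  also have "\<dots> = c j" using j by simp
  finally show "c j = 0" by simp
qed

end

section \<open>A module of functions on the cube\<close>

text \<open>
  The module is the one in which the list \<open>X_m, X_m u\<close> ought to become a basis of unit vectors: the product of
  \<open>w\<close> with the \<open>s_i\<close> for \<open>i\<close> in a set \<open>P\<close> (in decreasing order), followed by \<open>u\<close> if \<open>b\<close> holds, is to be
  the unit vector at \<open>(b, P)\<close>. The relations then force the operators below. To multiply by \<open>s_i\<close>, move it
  past \<open>s_{i-1}\<close>: it toggles \<open>i\<close>, and if \<open>i - 1\<close> lies in \<open>P\<close> there is a further term, in
  which \<open>i - 1\<close> is removed. Moving \<open>a\<close> to \<open>w\<close> inverts it once for each factor, so it acts by \<open>\<alpha>\<close> or
  \<open>1/\<alpha>\<close>, depending on a parity. Only indices up to \<open>m\<close> are counted, so that toggling changes the parity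
  also when \<open>P\<close> is infinite.
\<close>

definition odd_weight :: "nat \<Rightarrow> (nat \<Rightarrow> bool) \<Rightarrow> bool" where
  "odd_weight m P \<longleftrightarrow> odd (card {i. i \<le> m \<and> P i})"

definition chi :: "nat \<Rightarrow> bool \<Rightarrow> (nat \<Rightarrow> bool) \<Rightarrow> adj_ring" where
  "chi m b P = (if b \<noteq> odd_weight m P then R_alpha_inv else R_alpha)"

type_synonym cube_fun = "bool \<times> (nat \<Rightarrow> bool) \<Rightarrow> adj_ring"

text \<open>
  On coefficient functions the operators are transposed, so "remove \<open>i\<close>" reads off the value at \<open>P\<close> with \<open>i\<close>
  inserted. The element \<open>y_i\<close> is \<open>u s_i\<close>, hence the negation of \<open>b\<close>. For \<open>i = 1\<close> nothing is toggled, as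
  \<open>s_1\<close> fixes \<open>w\<close>, and \<open>s_2 s_1 = s_1 s_2 + 1\<close> contributes the removal of 2; for \<open>i = 2\<close> there is no
  factor \<open>s_1\<close> to move past.
\<close>

fun rep_y :: "nat \<Rightarrow> cube_fun \<Rightarrow> cube_fun" where
  "rep_y i f (b, P) =
    (if i = 1 then f (\<not> b, P) else f (\<not> b, P(i := \<not> P i))) +
    (if i = 1 then (if P 2 then 0 else f (\<not> b, P(2 := True)))
     else if i = 2 \<or> P (i - 1) then 0 else f (\<not> b, P(i - 1 := True)))"

fun rep_v1 :: "nat \<Rightarrow> cube_fun \<Rightarrow> cube_fun" where
  "rep_v1 m f (b, P) = R_s_inv * chi m b P * f (\<not> b, P)"

text \<open>
  Index 0 is \<open>u\<close>, and index \<open>i > 0\<close> is \<open>v_i = v_1 + y_1 + \<dots> + y_{i-1}\<close>.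
\<close>

fun rep :: "nat \<Rightarrow> nat \<Rightarrow> cube_fun \<Rightarrow> cube_fun" where
  "rep m i f (b, P) = (if i = 0 then f (\<not> b, P) else rep_v1 m f (b, P) + (\<Sum>j=1..<i. rep_y j f (b, P)))"

declare rep_y.simps [simp del] rep_v1.simps [simp del] rep.simps [simp del]

lemma odd_weight_upd:
  assumes "i \<le> m"
  shows "odd_weight m (P(i := b)) = (odd_weight m P \<noteq> (P i \<noteq> b))"
proof -
  let ?N = "{k. k \<le> m \<and> k \<noteq> i \<and> P k}"
  have fin: "finite ?N" by simp
  have "{k. k \<le> m \<and> Q k} = (if Q i then insert i ?N else ?N)" if "\<And>k. k \<noteq> i \<Longrightarrow> Q k = P k" for Q
  proof (rule Set.set_eqI)
    fix k
    show "k \<in> {k. k \<le> m \<and> Q k} \<longleftrightarrow> k \<in> (if Q i then insert i ?N else ?N)"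
      using that[of k] assms by (cases "k = i") auto
  qed
  from this[of P] this[of "P(i := b)"] show ?thesis
    unfolding odd_weight_def using fin by (simp split: if_splits)
qed

lemma chi_upd:
  "i \<le> m \<Longrightarrow> chi m b (P(i := c)) = chi m (b \<noteq> (P i \<noteq> c)) P"
  by (auto simp: chi_def odd_weight_upd)

lemma chi_not: "chi m (\<not> b) P + chi m b P = R_s"
  by (simp add: chi_def R_alpha_plus_alpha_inv add.commute[of R_alpha_inv])

lemma chi_mult_not: "chi m b P * chi m (\<not> b) P = 1"
  by (simp add: chi_def R_alpha_alpha_inv mult.commute[of R_alpha_inv])

lemma rep_y_add: "rep_y i (\<lambda>x. f x + g x) x = rep_y i f x + rep_y i g x"
  by (cases x) (simp add: rep_y.simps)

lemma rep_y_scale: "rep_y i (\<lambda>x. c * f x) x = c * rep_y i f x"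
  by (cases x) (simp add: rep_y.simps distrib_left)

lemma rep_v1_add: "rep_v1 m (\<lambda>x. f x + g x) x = rep_v1 m f x + rep_v1 m g x"
  by (cases x) (simp add: rep_v1.simps distrib_left)

lemma rep_v1_scale: "rep_v1 m (\<lambda>x. c * f x) x = c * rep_v1 m f x"
  by (cases x) (simp add: rep_v1.simps)

lemma R_add_cancel: "(x::adj_ring) + (x + y) = y"
  by (simp add: R_double flip: add.assoc)

lemma rep_y_y_sq: "1 \<le> i \<Longrightarrow> rep_y i (rep_y i f) x = f x"
  by (cases x; cases "i = 1"; cases "i = 2")
    (auto simp: rep_y.simps R_double R_add_cancel fun_upd_twist add.assoc)

text \<open>
  The bilinear form of \<open>y_i\<close> and \<open>y_j\<close> is 1 for neighbours and 0 otherwise. The computation depends on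
  which of the special indices 1 and 2 occur, and on whether \<open>j - 1\<close> meets \<open>i\<close>.
\<close>

lemma rep_y_y:
  assumes "1 \<le> i" "i < j"
  shows "rep_y i (rep_y j f) x + rep_y j (rep_y i f) x = (if j = Suc i then f x else 0)"
proof -
  obtain b P where x: "x = (b, P)" by fastforce
  consider "i = 1" "j = 2" | "i = 1" "j = 3" | "i = 1" "3 < j" | "i = 2" | "3 \<le> i" "j = Suc i" | "3 \<le> i" "Suc i < j"
    using assms by linarith
  then show ?thesis
  proof cases
    case 1
    then show ?thesis by (auto simp: x rep_y.simps R_double R_add_cancel fun_upd_idem ac_simps)
  next
    case 2
    then show ?thesis by (auto simp: x rep_y.simps R_double R_add_cancel fun_upd_twist ac_simps)
  next
    case 3
    then show ?thesis by (auto simp: x rep_y.simps R_double R_add_cancel fun_upd_twist[of 2] ac_simps)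
  next
    case 4
    then show ?thesis using assms
      by (auto simp: x rep_y.simps R_double R_add_cancel fun_upd_twist[of 2] fun_upd_idem ac_simps)
  next
    case 5
    moreover obtain l where "i = Suc l" using assms by (cases i) auto
    ultimately show ?thesis
      by (auto simp: x rep_y.simps R_double R_add_cancel fun_upd_twist[of l] fun_upd_twist[of "Suc l" "Suc (Suc l)"]
          fun_upd_idem ac_simps)
  next
    case 6
    moreover obtain l k where "i = Suc l" "j = Suc k" using assms by (cases i; cases j) auto
    ultimately show ?thesis
      by (auto simp: x rep_y.simps R_double R_add_cancel fun_upd_twist[of l]
          fun_upd_twist[of "Suc l" k] fun_upd_twist[of "Suc l" "Suc k"] fun_upd_twist[of k "Suc k"]
          fun_upd_idem ac_simps)
  qed
qed

lemma rep_v1_sq: "rep_v1 m (rep_v1 m f) x = R_t_inv * f x"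
proof -
  obtain b P where x: "x = (b, P)" by fastforce
  have "rep_v1 m (rep_v1 m f) x = R_s_inv\<^sup>2 * (chi m b P * chi m (\<not> b) P) * f x"
    by (simp add: x rep_v1.simps power2_eq_square ac_simps)
  then show ?thesis by (simp add: chi_mult_not R_t_inv_def)
qed

lemma rep_v1_y:
  assumes "1 \<le> i" "i < m"
  shows "rep_v1 m (rep_y i f) x + rep_y i (rep_v1 m f) x = (if i = 1 then f x else 0)"
proof -
  obtain b P where x: "x = (b, P)" by fastforce
  show ?thesis
  proof (cases "i = 1")
    case True
    have "R_s_inv * chi m (\<not> b) P * f x + R_s_inv * chi m b P * f x
        = (R_s_inv * (chi m (\<not> b) P + chi m b P)) * f x"
      by (simp add: algebra_simps)
    also have "\<dots> = f x" by (simp add: chi_not R_s_s_inv mult.commute[of R_s_inv])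
    finally have "R_s_inv * chi m (\<not> b) P * f x + R_s_inv * chi m b P * f x = f x" .
    then show ?thesis using assms True
      by (auto simp: x rep_y.simps rep_v1.simps chi_upd distrib_left add.assoc R_double R_add_cancel)
        (auto simp: ac_simps R_two)
  next
    case False
    then show ?thesis using assms
      by (auto simp: x rep_y.simps rep_v1.simps chi_upd distrib_left R_double R_two R_add_cancel add.assoc)
  qed
qed

lemma rep_0: "rep m 0 f (b, P) = f (\<not> b, P)"
  by (simp add: rep.simps)

lemma rep_1: "rep m 1 f = rep_v1 m f"
  by (auto simp: rep.simps fun_eq_iff)

lemma rep_Suc: "1 \<le> i \<Longrightarrow> rep m (Suc i) f = (\<lambda>x. rep m i f x + rep_y i f x)"
  by (auto simp: rep.simps fun_eq_iff add.assoc)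

lemma rep_add: "rep m i (\<lambda>x. f x + g x) x = rep m i f x + rep m i g x"
  by (cases x) (simp add: rep.simps rep_v1_add rep_y_add sum.distrib ac_simps)

lemma rep_scale: "rep m i (\<lambda>x. c * f x) x = c * rep m i f x"
  by (cases x) (simp add: rep.simps rep_v1_scale rep_y_scale sum_distrib_left distrib_left)

lemma rep_0_sq: "rep m 0 (rep m 0 f) x = f x"
  by (cases x) (simp add: rep_0)

lemma rep_0_y: "rep_y i (rep m 0 f) x = rep m 0 (rep_y i f) x"
  by (cases x) (simp add: rep_0 rep_y.simps)

lemma rep_0_v:
  assumes "1 \<le> i"
  shows "rep m 0 (rep m i f) x + rep m i (rep m 0 f) x = f x"
  using assms
proof (induction i rule: dec_induct)
  case base
  obtain b P where x: "x = (b, P)" by fastforce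
  have "rep m 0 (rep m 1 f) x + rep m 1 (rep m 0 f) x
        = (R_s_inv * (chi m (\<not> b) P + chi m b P)) * f x"
    by (simp only: rep_1) (simp add: x rep_0 rep_v1.simps algebra_simps)
  then show ?case by (simp add: chi_not R_s_s_inv mult.commute[of R_s_inv])
next
  case (step i)
  then show ?case
    by (simp add: rep_Suc rep_add rep_0_y ac_simps R_double R_add_cancel)
qed

lemma rep_v_y:
  assumes "1 \<le> i" "i \<le> k" "k < m"
  shows "rep m i (rep_y k f) x + rep_y k (rep m i f) x = (if k = i then f x else 0)"
  using assms
proof (induction i rule: dec_induct)
  case base
  then show ?case unfolding rep_1 by (rule rep_v1_y)
next
  case (step i)
  have "rep m (Suc i) (rep_y k f) x + rep_y k (rep m (Suc i) f) x =
      (rep m i (rep_y k f) x + rep_y k (rep m i f) x) +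
      (rep_y i (rep_y k f) x + rep_y k (rep_y i f) x)"
    using step.hyps by (simp add: rep_Suc rep_y_add ac_simps)
  then show ?case using step rep_y_y[of i k f x] by simp
qed

lemma rep_v_sq:
  assumes "1 \<le> i" "i \<le> m"
  shows "rep m i (rep m i f) x = R_t_inv * f x"
  using assms
proof (induction i rule: dec_induct)
  case base
  then show ?case by (simp only: rep_1 rep_v1_sq)
next
  case (step i)
  have "rep m (Suc i) (rep m (Suc i) f) x = rep m i (rep m i f) x +
      (rep m i (rep_y i f) x + rep_y i (rep m i f) x) + rep_y i (rep_y i f) x"
    using step.hyps by (simp add: rep_Suc rep_add rep_y_add ac_simps)
  then show ?case using step rep_v_y[of i i m f x] rep_y_y_sq[of i f x]
    by (simp add: add.assoc R_double)
qed

text \<open>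
  The relations between the \<open>v_i\<close> follow from those between \<open>v_1\<close> and the \<open>y_i\<close> by induction, as
  the form is bilinear.
\<close>

lemma rep_v_v:
  assumes "1 \<le> i" "i < j" "j \<le> m"
  shows "rep m i (rep m j f) x + rep m j (rep m i f) x = f x"
  using assms(2,1,3)
proof (induction j)
  case (Suc j)
  have eq: "rep m i (rep m (Suc j) f) x + rep m (Suc j) (rep m i f) x =
      (rep m i (rep m j f) x + rep m j (rep m i f) x) +
      (rep m i (rep_y j f) x + rep_y j (rep m i f) x)"
    using Suc.prems by (simp add: rep_Suc rep_add ac_simps)
  show ?case
  proof (cases "i = j")
    case True
    then show ?thesis using eq Suc.prems rep_v_y[of i j m f x] by (simp add: R_double)
  next
    case False
    then show ?thesis using eq Suc rep_v_y[of i j m f x] by simp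
  qed
qed simp

lemma clifford_module_rep: "clifford_module m (rep m)"
proof
  show "rep m i (\<lambda>x. f x + g x) = (\<lambda>x. rep m i f x + rep m i g x)" for i f g
    by (rule ext) (rule rep_add)
  show "rep m i (\<lambda>x. c * f x) = (\<lambda>x. c * rep m i f x)" for i c f
    by (rule ext) (rule rep_scale)
  show "rep m i (rep m i f) x = (if i = 0 then 1 else R_t_inv) * f x" if "i \<le> m" for i f x
    using that rep_v_sq[of i m f x] by (cases "i = 0") (simp_all add: rep_0_sq)
  show "rep m i (rep m j f) x + rep m j (rep m i f) x = f x"
    if "i \<le> m" "j \<le> m" "i \<noteq> j" for i j f x
  proof (cases i j rule: linorder_cases)
    case less
    then show ?thesis using that rep_0_v[of j m f x] rep_v_v[of i j m f x] by (cases "i = 0") auto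
  next
    case greater
    then show ?thesis
      using that rep_0_v[of i m f x] rep_v_v[of j i m f x] by (cases "j = 0") (auto simp: add.commute)
  qed (use that in simp)
qed

section \<open>Linear independence and the action on the sum\<close>

text \<open>
  The positions of the unit vectors that correspond to the elements of \<open>X_m\<close>, in the same order.
\<close>

primrec cubes :: "nat \<Rightarrow> nat \<Rightarrow> (nat \<Rightarrow> bool) list" where
  "cubes m 0 = [\<lambda>_. False]"
| "cubes m (Suc k) = cubes m k @ map (\<lambda>P. P(m - Suc k := True)) (cubes m k)"

lemma cubes_bounds: "k \<le> m \<Longrightarrow> P \<in> set (cubes m k) \<Longrightarrow> P i \<Longrightarrow> m - k \<le> i \<and> i < m"
proof (induction k arbitrary: P)
  case (Suc k)
  then show ?case by (fastforce split: if_splits)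
qed simp

lemma distinct_cubes: "k \<le> m \<Longrightarrow> distinct (cubes m k)"
proof (induction k)
  case (Suc k)
  have out: "\<not> P (m - Suc k)" if "P \<in> set (cubes m k)" for P
    using cubes_bounds[of k m P "m - Suc k"] that Suc.prems by auto
  have "inj_on (\<lambda>P. P(m - Suc k := True)) (set (cubes m k))"
  proof (rule inj_onI)
    fix P Q assume PQ: "P \<in> set (cubes m k)" "Q \<in> set (cubes m k)"
      and eq: "P(m - Suc k := True) = Q(m - Suc k := True)"
    show "P = Q"
    proof
      fix i show "P i = Q i"
        using fun_cong[OF eq, of i] out[OF PQ(1)] out[OF PQ(2)] by (auto split: if_splits)
    qed
  qed
  moreover have "P(m - Suc k := True) \<notin> set (cubes m k)" for P
    using out[of "P(m - Suc k := True)"] by auto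
  ultimately show ?case using Suc by (auto simp: distinct_map)
qed simp

context
  fixes m :: nat
  assumes m: "3 \<le> m"
begin

interpretation G: clifford_generators "Cl m" "cl_scale m" m "cl_vec m (V_u m)" "\<lambda>i. cl_vec m (V_v m i)"
  by (rule Cl_clifford_generators[OF m])

interpretation R: clifford_module m "rep m"
  by (rule clifford_module_rep)

lemma act_u: "R.act (cl_vec m (V_u m)) f = rep m 0 f"
  using R.act_vec[of 0 f] by (simp add: V_u_def)

lemma act_v: "i \<le> m \<Longrightarrow> R.act (cl_vec m (V_v m i)) f = rep m i f"
  using R.act_vec[of i f] by (simp add: V_v_def)

lemma act_S:
  assumes "1 \<le> i" "i < m"
  shows "R.act (G.S i) f = rep_y i (rep m 0 f)"
  unfolding G.S_def G.y_def using assms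
  by (simp add: R.act_mult R.act_add act_u act_v rep_Suc fun_eq_iff R_add_cancel)

lemma act_A: "R.act G.A f (b, P) = chi m b P * f (b, P)"
proof -
  have "R.act G.A f (b, P) = (R_s * R_s_inv) * (chi m b P * f (b, P))"
    unfolding G.A_def using m act_v[of 1]
    by (simp add: R.act_mult R.act_scale act_u rep_1[unfolded One_nat_def] rep_v1.simps rep_0 ac_simps)
  then show ?thesis by (simp add: R_s_s_inv)
qed

text \<open>
  The factor \<open>1 + S_1\<close> only removes 2, so it maps the unit vector at \<open>{2}\<close> to the one at the
  empty set; there \<open>A + 1/\<alpha>\<close> acts by the unit \<open>\<alpha> + 1/\<alpha> = s\<close>, which the scalar in
  front cancels.
\<close>

lemma act_w:
  "R.act G.w (\<lambda>x. R_s_inv * R.delta (False, \<lambda>i. i = 2) x) = R.delta (False, \<lambda>_. False)"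
proof -
  let ?f = "\<lambda>x. R_s_inv * R.delta (False, \<lambda>i. i = (2::nat)) x"
  let ?g = "\<lambda>x. R_s_inv * R.delta (False, \<lambda>_::nat. False) x"
  have g: "R.act (\<one>\<^bsub>Cl m\<^esub> \<oplus>\<^bsub>Cl m\<^esub> G.S 1) ?f = ?g"
  proof
    fix x :: "bool \<times> (nat \<Rightarrow> bool)"
    obtain b P where x: "x = (b, P)" by fastforce
    have "(P(2 := True) = (\<lambda>i. i = 2)) = (P = (\<lambda>_. False))" if "\<not> P 2"
      using that by (auto simp: fun_eq_iff) metis
    then show "R.act (\<one>\<^bsub>Cl m\<^esub> \<oplus>\<^bsub>Cl m\<^esub> G.S 1) ?f x = ?g x"
      using m act_S[of 1 ?f]
      by (auto simp: x R.act_add R.act_one rep_y.simps rep_0 R.delta_def R_double R_add_cancel)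
  qed
  have "R.act G.w ?f (b, P) = R.delta (False, \<lambda>_. False) (b, P)" for b P
  proof -
    have chi: "chi m False (\<lambda>_. False) = R_alpha" by (simp add: chi_def odd_weight_def)
    have "R.act G.w ?f (b, P) = (chi m b P + R_alpha_inv) * ?g (b, P)"
      unfolding G.w_def using g by (simp add: R.act_mult R.act_add R.act_scale R.act_one act_A distrib_right)
    also have "\<dots> = (R_alpha + R_alpha_inv) * ?g (b, P)"
      by (simp add: R.delta_def chi)
    also have "\<dots> = (R_s * R_s_inv) * R.delta (False, \<lambda>_. False) (b, P)"
      by (simp add: R_alpha_plus_alpha_inv mult.assoc)
    finally show ?thesis by (simp add: R_s_s_inv)
  qed
  then show ?thesis by (auto simp: fun_eq_iff)
qed

text \<open>
  Each doubling uses an index \<open>i\<close> below all previous ones, so the removal of \<open>i - 1\<close> does not occur.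
\<close>

lemma act_S_delta:
  assumes "2 \<le> i" "i < m" "\<not> P i" "\<not> P (i - 1)"
  shows "R.act (G.S i) (R.delta (b, P)) = R.delta (b, P(i := True))"
proof
  fix x :: "bool \<times> (nat \<Rightarrow> bool)"
  obtain c Q where x: "x = (c, Q)" by fastforce
  have "(Q(i := \<not> Q i) = P) = (Q = P(i := True))"
    using assms(3) by (auto simp: fun_eq_iff)
  moreover have "Q(i - 1 := True) \<noteq> P"
    using assms(4) by (metis fun_upd_same)
  ultimately show "R.act (G.S i) (R.delta (b, P)) x = R.delta (b, P(i := True)) x"
    using assms by (simp add: act_S x rep_y.simps rep_0 R.delta_def)
qed

lemma act_X:
  assumes "k \<le> m - 2"
  defines "f \<equiv> \<lambda>x. R_s_inv * R.delta (False, \<lambda>i. i = 2) x"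
  shows "map (\<lambda>x. R.act x f) (G.X k) = map (\<lambda>P. R.delta (False, P)) (cubes m k)"
  using assms(1)
proof (induction k)
  case 0
  show ?case by (simp add: f_def act_w)
next
  case (Suc k)
  let ?i = "m - Suc k"
  have i: "2 \<le> ?i" "?i < m" using Suc.prems by auto
  have X: "set (G.X k) \<subseteq> carrier (Cl m)" using Suc.prems by (intro G.X_closed) simp
  have "map (\<lambda>x. R.act (x \<otimes>\<^bsub>Cl m\<^esub> G.S ?i) f) (G.X k) = map (R.act (G.S ?i)) (map (\<lambda>x. R.act x f) (G.X k))"
    using X i by (auto simp: R.act_mult subset_eq)
  also have "\<dots> = map (R.act (G.S ?i)) (map (\<lambda>P. R.delta (False, P)) (cubes m k))"
    using Suc by simp
  also have "\<dots> = map (\<lambda>P. R.delta (False, P(?i := True))) (cubes m k)"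
  proof -
    have "R.act (G.S ?i) (R.delta (False, P)) = R.delta (False, P(?i := True))" if "P \<in> set (cubes m k)" for P
    proof -
      have "\<not> P j" if "j \<le> ?i" for j
        using cubes_bounds[OF _ \<open>P \<in> set (cubes m k)\<close>, of j] that Suc.prems by linarith
      then show ?thesis by (intro act_S_delta i) simp_all
    qed
    then show ?thesis by simp
  qed
  finally show ?case using Suc by (simp add: comp_def)
qed

lemma act_u_delta: "rep m 0 (R.delta (b, P)) = R.delta (\<not> b, P)"
  by (auto simp: fun_eq_iff rep_0 R.delta_def)

lemma indep_L: "Cl.indep m G.L"
proof -
  let ?f = "\<lambda>x. R_s_inv * R.delta (False, \<lambda>i. i = (2::nat)) x"
  let ?C = "cubes m (m - 2)"
  have X: "set (G.X (m - 2)) \<subseteq> carrier (Cl m)" by (rule G.X_closed) simp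
  have "map (\<lambda>x. R.act (x \<otimes>\<^bsub>Cl m\<^esub> cl_vec m (V_u m)) ?f) (G.X (m - 2))
      = map (rep m 0) (map (\<lambda>x. R.act x ?f) (G.X (m - 2)))"
    using X by (auto simp: R.act_mult act_u subset_eq)
  also have "\<dots> = map (\<lambda>P. R.delta (True, P)) ?C"
    by (simp add: act_X act_u_delta)
  finally have "map (\<lambda>x. R.act x ?f) G.L = map R.delta (map (Pair False) ?C @ map (Pair True) ?C)"
    using act_X[of "m - 2"] by (simp add: G.L_def comp_def)
  moreover have "distinct (map (Pair False) ?C @ map (Pair True) ?C)"
    using distinct_cubes[of "m - 2" m] by (auto simp: distinct_map inj_on_def)
  ultimately show ?thesis using R.indep_if_act_delta[OF G.L_closed] by blast
qed

lemma span_L_right_ideal: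
  assumes "x \<in> Cl.span m G.L" "g \<in> carrier (Cl m)"
  shows "x \<otimes>\<^bsub>Cl m\<^esub> g \<in> Cl.span m G.L"
proof (rule Cl_right_ideal[OF Cl.span_closed[OF G.L_closed] Cl.span_0[OF G.L_closed]
      Cl.span_add[OF G.L_closed] Cl.span_scale[OF G.L_closed] _ assms])
  fix i x assume "i \<le> m" "x \<in> Cl.span m G.L"
  then show "x \<otimes>\<^bsub>Cl m\<^esub> cl_vec m (unit_vec (m + 1) i) \<in> Cl.span m G.L"
    using G.span_L_right_u[of x] G.span_L_right_v[of x i]
    by (cases "i = 0") (simp_all add: V_u_def V_v_def)
qed

context
  fixes \<psi> :: "ygen gword set \<times> bool \<Rightarrow> cl_elem"
  assumes psi: "is_psi m \<psi>"
begin

lemma psi_tau: "\<psi> (yt_tau m) = cl_vec m (V_u m)"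
  using psi by (simp add: is_psi_def)

lemma psi_a: "\<psi> (yt_a m) = G.A"
  using psi by (simp add: is_psi_def G.A_def)

lemma psi_s: "1 \<le> i \<Longrightarrow> i < m \<Longrightarrow> \<psi> (yt_s m i) = G.S i"
proof -
  assume "1 \<le> i" "i < m"
  moreover have "V_v m j \<in> carrier_vec (m + 1)" for j by (simp add: V_v_def)
  ultimately show ?thesis
    using psi by (simp add: is_psi_def G.S_def G.y_def cl_vec_add)
qed

lemma X_step_eq: "k \<le> m - 2 \<Longrightarrow> X_step m \<psi> k = G.X k"
proof (induction k)
  case 0
  show ?case using G.w_expand by (simp add: cl_w_def)
next
  case (Suc k)
  then show ?case by (simp add: psi_s)
qed

lemma X_list_eq: "X_list m \<psi> = G.X (m - 2)"
  by (simp add: X_list_def X_step_eq)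

lemma L_eq: "X_list m \<psi> @ Xu_list m \<psi> = G.L"
  by (simp add: Xu_list_def X_list_eq G.L_def)

lemma psi_closed: "g \<in> carrier (ytilde m) \<Longrightarrow> \<psi> g \<in> carrier (Cl m)"
proof -
  assume g: "g \<in> carrier (ytilde m)"
  have "\<psi> \<in> hom (ytilde m) (units_of (Cl m))" using psi by (simp add: is_psi_def)
  then have "\<psi> g \<in> carrier (units_of (Cl m))" using g by (auto simp: hom_def)
  then show ?thesis by (simp add: units_of_carrier Units_def)
qed

lemma Wu_mod_eq: "Wu_mod m \<psi> = Cl.span m (Xu_list m \<psi>)"
  unfolding Wu_mod_def W_mod_def Xu_list_def cl_span_eq
  by (subst Cl.span_map_mult) (simp_all add: X_list_eq G.X_closed)

lemma action_on_W_plus_Wu: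
  defines "L \<equiv> X_list m \<psi> @ Xu_list m \<psi>"
    and "n \<equiv> (2::nat) ^ (m - 2)"
    and "M \<equiv> W_mod m \<psi> <+>\<^bsub>Cl m\<^esub> Wu_mod m \<psi>"
  shows "W_mod m \<psi> \<inter> Wu_mod m \<psi> = {\<zero>\<^bsub>Cl m\<^esub>}"
    and "cl_ordered_basis m L M"
    and "length L = 2 ^ (m - 1)"
    and "\<forall>g\<in>carrier (ytilde m). \<forall>x\<in>M. x \<otimes>\<^bsub>Cl m\<^esub> \<psi> g \<in> M"
    and "right_mult_matrix m L (\<psi> (yt_tau m))
        (four_block_mat (0\<^sub>m n n) (1\<^sub>m n) (1\<^sub>m n) (0\<^sub>m n n))"
    and "eta_a m \<in> Units (Mat_ring n)"
    and "right_mult_matrix m L (\<psi> (yt_a m))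
        (four_block_mat (eta_a m) (0\<^sub>m n n) (0\<^sub>m n n) (inv\<^bsub>Mat_ring n\<^esub> (eta_a m)))"
    and "\<forall>i. 1 \<le> i \<and> i \<le> m - 1 \<longrightarrow>
        right_mult_matrix m L (\<psi> (yt_s m i))
          (four_block_mat (eta_s m i) (0\<^sub>m n n) (0\<^sub>m n n) (eta_s m i))"
proof -
  have L: "L = G.L" unfolding L_def by (rule L_eq)
  have closed: "set (X_list m \<psi>) \<subseteq> carrier (Cl m)" "set (Xu_list m \<psi>) \<subseteq> carrier (Cl m)"
    using G.L_closed unfolding L_eq[symmetric] by auto
  have M: "M = Cl.span m L"
    unfolding M_def L_def Wu_mod_eq W_mod_def cl_span_eq by (rule Cl.span_append[OF closed, symmetric])
  have indep: "Cl.indep m L" unfolding L by (rule indep_L)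
  show "W_mod m \<psi> \<inter> Wu_mod m \<psi> = {\<zero>\<^bsub>Cl m\<^esub>}"
    unfolding Wu_mod_eq W_mod_def cl_span_eq
    by (rule Cl.indep_append_span_Int[OF closed indep[unfolded L_def]])
  show "cl_ordered_basis m L M"
    unfolding cl_ordered_basis_def cl_indep_eq cl_span_eq M using indep G.L_closed L by simp
  have "m - 1 = Suc (m - 2)" using m by simp
  then show "length L = 2 ^ (m - 1)" by (simp add: L G.L_def)
  show "\<forall>g\<in>carrier (ytilde m). \<forall>x\<in>M. x \<otimes>\<^bsub>Cl m\<^esub> \<psi> g \<in> M"
    unfolding M L using span_L_right_ideal psi_closed by blast
  show "right_mult_matrix m L (\<psi> (yt_tau m))
        (four_block_mat (0\<^sub>m n n) (1\<^sub>m n) (1\<^sub>m n) (0\<^sub>m n n))"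
    unfolding right_mult_matrix_eq L n_def psi_tau by (rule G.L_acts(1))
  show "eta_a m \<in> Units (Mat_ring n)" unfolding n_def by (rule G.X_acts(1))
  show "right_mult_matrix m L (\<psi> (yt_a m))
        (four_block_mat (eta_a m) (0\<^sub>m n n) (0\<^sub>m n n) (inv\<^bsub>Mat_ring n\<^esub> (eta_a m)))"
    unfolding right_mult_matrix_eq L n_def psi_a by (rule G.L_acts(2))
  show "\<forall>i. 1 \<le> i \<and> i \<le> m - 1 \<longrightarrow>
        right_mult_matrix m L (\<psi> (yt_s m i))
          (four_block_mat (eta_s m i) (0\<^sub>m n n) (0\<^sub>m n n) (eta_s m i))"
    unfolding right_mult_matrix_eq L n_def using G.L_acts(3) m by (auto simp: psi_s)
qed

end

end

theorem corollary4p8: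
  fixes m :: nat
    and \<psi> :: "ygen gword set \<times> bool \<Rightarrow> cl_elem"
  assumes "3 \<le> m"
    and "is_psi m \<psi>"
  defines "L \<equiv> X_list m \<psi> @ Xu_list m \<psi>"
    and "n \<equiv> (2::nat) ^ (m - 2)"
    and "M \<equiv> W_mod m \<psi> <+>\<^bsub>Cl m\<^esub> Wu_mod m \<psi>"
  shows "W_mod m \<psi> \<inter> Wu_mod m \<psi> = {\<zero>\<^bsub>Cl m\<^esub>}
    \<and> cl_ordered_basis m L M
    \<and> length L = 2 ^ (m - 1)
    \<and> (\<forall>g\<in>carrier (ytilde m). \<forall>x\<in>M. x \<otimes>\<^bsub>Cl m\<^esub> \<psi> g \<in> M)
    \<and> right_mult_matrix m L (\<psi> (yt_tau m))
        (four_block_mat (0\<^sub>m n n) (1\<^sub>m n) (1\<^sub>m n) (0\<^sub>m n n))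
    \<and> eta_a m \<in> Units (Mat_ring n)
    \<and> right_mult_matrix m L (\<psi> (yt_a m))
        (four_block_mat (eta_a m) (0\<^sub>m n n) (0\<^sub>m n n) (inv\<^bsub>Mat_ring n\<^esub> (eta_a m)))
    \<and> (\<forall>i. 1 \<le> i \<and> i \<le> m - 1 \<longrightarrow>
        right_mult_matrix m L (\<psi> (yt_s m i))
          (four_block_mat (eta_s m i) (0\<^sub>m n n) (0\<^sub>m n n) (eta_s m i)))"
  unfolding L_def n_def M_def using action_on_W_plus_Wu[OF assms(1,2)] by blast

end
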